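(* If a $|1|$-graded parabolic geometry $(\mathcal{G}\rightarrow M,\omega)$ carries a smooth system of symmetries $S:M\times M\to M$, $S(x,y)=s_x(y)$, such that $s_x\circ s_y\circ s_x=s_{s_x(y)}$ holds for each $x,y\in M$, then $(M,S)$ forms an affine symmetric space.
   Context: Geometries. Let $G$ be a semisimple Lie group whose Lie algebra carries a fixed grading $\mathfrak{g}=\mathfrak{g}_{-1}\oplus\mathfrak{g}_0\oplus\mathfrak{g}_1$, and let $P\subset G$ be the corresponding parabolic subgroup, i.e. the subgroup of elements whose adjoint action preserves the filtration $\mathfrak{g}\supset\mathfrak{g}_0\oplus\mathfrak{g}_1\supset\mathfrak{g}_1$; its Lie algebra is $\mathfrak{p}=\mathfrak{g}_0\oplus\mathfrak{g}_1$. A $|1|$-graded parabolic geometry of type $(G,P)$ on a smooth manifold $M$ is a principal $P$-bundle $\mathcal{G}\to M$ with a Cartan connection $\omega\in\Omega^1(\mathcal{G},\mathfrak{g})$ (a $P$-equivariant one-form reproducing generators of fundamental vector fields and giving linear isomorphisms $T_u\mathcal{G}\cong\mathfrak{g}$). Automorphisms are principal bundle automorphisms $\varphi$ of $\mathcal{G}$ with $\varphi^*\omega=\omega$. Throughout, $M$ is connected and the geometry is effective (the maximal normal subgroup of $G$ contained in $P$ is trivial), so an automorphism is uniquely determined by its base map on $M$. Symmetries. A symmetry centered at $x\in M$ is a diffeomorphism $s_x$ of $M$ with $s_x(x)=x$, $T_xs_x=-\mathrm{id}$ on $T_xM$, which is covered by an automorphism of the geometry. A system of symmetries is a map $S:M\times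 M\to M$, $S(x,y)=s_x(y)$, obtained by choosing one symmetry $s_x$ centered at $x$ for each $x\in M$; it is smooth if the map $S$ is smooth. Affine symmetric spaces. An affine symmetric space is a manifold $M$ with an affine connection $\nabla$ such that at each $x\in M$ there is a globally defined diffeomorphism $s_x$ of $M$ with $s_x(x)=x$, $T_xs_x=-\mathrm{id}$, which is an affine transformation of $\nabla$. That $(M,S)$ forms an affine symmetric space means that there is an affine connection $\nabla$ on $M$ such that the symmetries $s_x$ of the system $S$ are affine transformations of $\nabla$ (so that $(M,\nabla)$ is an affine symmetric space with symmetries $s_x$). *)

theory Defs
  imports
    "HOL-Analysis.Analysis"
    "HOL-Algebra.Coset"
    "HOL-Library.Function_Algebras"
begin

section \<open>Functions as a real vector space\<close>

text \<open>Tangent vectors are encoded below as functions from charts to a model space; the pointwise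
  structure makes the library notions \<^const>\<open>subspace\<close> and \<^const>\<open>span\<close> available for them.\<close>

instantiation "fun" :: (type, real_vector) real_vector
begin

definition scaleR_fun_def: "scaleR r f = (\<lambda>x. r *\<^sub>R f x)"

instance
  by standard (auto simp: scaleR_fun_def fun_eq_iff scaleR_add_right scaleR_add_left)

end

section \<open>Smooth maps between Euclidean spaces\<close>

text \<open>\<open>Ck_on k S f\<close>: on the open set \<open>S\<close> all iterated directional derivatives of \<open>f\<close> of order
  at most \<open>k\<close> exist and are continuous; in finite dimension this is the usual class \<open>C^k\<close>.\<close>

primrec Ck_on ::
  "nat \<Rightarrow> 'a::real_normed_vector set \<Rightarrow> ('a \<Rightarrow> 'b::real_normed_vector) \<Rightarrow> bool" where
  "Ck_on 0 S f \<longleftrightarrow> continuous_on S f"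
| "Ck_on (Suc k) S f \<longleftrightarrow>
     (\<forall>x\<in>S. f differentiable (at x)) \<and>
     (\<forall>v. Ck_on k S (\<lambda>x. frechet_derivative f (at x) v))"

definition smooth_on ::
  "'a::real_normed_vector set \<Rightarrow> ('a \<Rightarrow> 'b::real_normed_vector) \<Rightarrow> bool" where
  "smooth_on S f \<longleftrightarrow> open S \<and> (\<forall>k. Ck_on k S f)"

section \<open>Smooth manifolds\<close>

text \<open>A chart is a pair of its domain and its coordinate map; values of the coordinate map outside
  of the domain are irrelevant. The atlas need not be maximal.\<close>

type_synonym ('a, 'e) chart = "'a set \<times> ('a \<Rightarrow> 'e)"

record ('a, 'e) manifold =
  mtop :: "'a topology"
  atlas :: "('a, 'e) chart set"

abbreviation points :: "('a, 'e, 'z) manifold_scheme \<Rightarrow> 'a set" where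
  "points M \<equiv> topspace (mtop M)"

abbreviation cdom :: "('a, 'e) chart \<Rightarrow> 'a set" where
  "cdom c \<equiv> fst c"

abbreviation cmap :: "('a, 'e) chart \<Rightarrow> 'a \<Rightarrow> 'e" where
  "cmap c \<equiv> snd c"

definition cinv :: "('a, 'e) chart \<Rightarrow> 'e \<Rightarrow> 'a" where
  "cinv c = inv_into (cdom c) (cmap c)"

definition smooth_manifold :: "('a, 'e::euclidean_space) manifold \<Rightarrow> bool" where
  "smooth_manifold M \<longleftrightarrow>
     Hausdorff_space (mtop M) \<and> second_countable (mtop M) \<and>
     (\<Union>c\<in>atlas M. cdom c) = points M \<and>
     (\<forall>c\<in>atlas M.
        openin (mtop M) (cdom c) \<and> open (cmap c ` cdom c) \<and>
        homeomorphic_map (subtopology (mtop M) (cdom c))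
          (top_of_set (cmap c ` cdom c)) (cmap c)) \<and>
     (\<forall>c\<in>atlas M. \<forall>d\<in>atlas M.
        smooth_on (cmap c ` (cdom c \<inter> cdom d)) (cmap d \<circ> cinv c))"

definition smooth_map ::
  "('a, 'e::euclidean_space) manifold \<Rightarrow> ('b, 'f::euclidean_space) manifold \<Rightarrow> ('a \<Rightarrow> 'b) \<Rightarrow> bool"
  where
  "smooth_map M N f \<longleftrightarrow>
     continuous_map (mtop M) (mtop N) f \<and>
     (\<forall>c\<in>atlas M. \<forall>d\<in>atlas N.
        smooth_on (cmap c ` (cdom c \<inter> f -` cdom d)) (cmap d \<circ> f \<circ> cinv c))"

definition smooth_function :: "('a, 'e::euclidean_space) manifold \<Rightarrow> ('a \<Rightarrow> real) \<Rightarrow> bool" where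
  "smooth_function M f \<longleftrightarrow> (\<forall>c\<in>atlas M. smooth_on (cmap c ` cdom c) (f \<circ> cinv c))"

definition diffeomorphism ::
  "('a, 'e::euclidean_space) manifold \<Rightarrow> ('b, 'f::euclidean_space) manifold \<Rightarrow> ('a \<Rightarrow> 'b) \<Rightarrow> bool"
  where
  "diffeomorphism M N f \<longleftrightarrow>
     bij_betw f (points M) (points N) \<and> smooth_map M N f \<and>
     smooth_map N M (inv_into (points M) f)"

definition prod_manifold ::
  "('a, 'e) manifold \<Rightarrow> ('b, 'f) manifold \<Rightarrow> ('a \<times> 'b, 'e \<times> 'f) manifold" where
  "prod_manifold M N =
     \<lparr>mtop = prod_topology (mtop M) (mtop N),
      atlas = {(cdom c \<times> cdom d, map_prod (cmap c) (cmap d)) | c d. c \<in> atlas M \<and> d \<in> atlas N}\<rparr>"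

definition open_submanifold :: "('a, 'e) manifold \<Rightarrow> 'a set \<Rightarrow> ('a, 'e) manifold" where
  "open_submanifold M U =
     \<lparr>mtop = subtopology (mtop M) U, atlas = (\<lambda>c. (cdom c \<inter> U, cmap c)) ` atlas M\<rparr>"

section \<open>Tangent vectors and vector fields\<close>

text \<open>A tangent vector at \<open>p\<close> is the family of its coordinate representatives in all the charts
  around \<open>p\<close>, related by the derivatives of the coordinate changes; that is, an equivalence class
  of pairs (chart, coordinate vector). The components at the remaining charts are zero.\<close>

type_synonym ('a, 'e) tvec = "('a, 'e) chart \<Rightarrow> 'e"

definition charts_at :: "('a, 'e) manifold \<Rightarrow> 'a \<Rightarrow> ('a, 'e) chart set" where
  "charts_at M p = {c \<in> atlas M. p \<in> cdom c}"

definition tangent_space :: "('a, 'e::euclidean_space) manifold \<Rightarrow> 'a \<Rightarrow> ('a, 'e) tvec set" where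
  "tangent_space M p =
     {v. (\<forall>c\<in>charts_at M p. \<forall>d\<in>charts_at M p.
            v d = frechet_derivative (cmap d \<circ> cinv c) (at (cmap c p)) (v c)) \<and>
         (\<forall>c. c \<notin> charts_at M p \<longrightarrow> v c = 0)}"

definition chart_around :: "('a, 'e) manifold \<Rightarrow> 'a \<Rightarrow> ('a, 'e) chart" where
  "chart_around M p = (SOME c. c \<in> charts_at M p)"

text \<open>On \<^term>\<open>tangent_space M p\<close> the following does not depend on the chosen chart around \<open>p\<close>,
  by the chain rule.\<close>

definition tangent_map ::
  "('a, 'e::euclidean_space) manifold \<Rightarrow> ('b, 'f::euclidean_space) manifold \<Rightarrow> ('a \<Rightarrow> 'b) \<Rightarrow> 'a
   \<Rightarrow> ('a, 'e) tvec \<Rightarrow> ('b, 'f) tvec" where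
  "tangent_map M N f p v =
     (let c = chart_around M p in
      (\<lambda>d. if d \<in> charts_at N (f p)
           then frechet_derivative (cmap d \<circ> f \<circ> cinv c) (at (cmap c p)) (v c) else 0))"

definition coord_vector ::
  "('a, 'e::euclidean_space) manifold \<Rightarrow> ('a, 'e) chart \<Rightarrow> 'e \<Rightarrow> 'a \<Rightarrow> ('a, 'e) tvec" where
  "coord_vector M c w p =
     (\<lambda>d. if d \<in> charts_at M p
          then frechet_derivative (cmap d \<circ> cinv c) (at (cmap c p)) w else 0)"

text \<open>Vector fields are extended by zero outside of the manifold, so that equality of fields is
  equality of functions.\<close>

definition vector_fields ::
  "('a, 'e::euclidean_space) manifold \<Rightarrow> ('a \<Rightarrow> ('a, 'e) tvec) set" where
  "vector_fields M =
     {X. (\<forall>p\<in>points M. X p \<in> tangent_space M p) \<and> (\<forall>p. p \<notin> points M \<longrightarrow> X p = 0) \<and>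
         (\<forall>c\<in>atlas M. smooth_on (cmap c ` cdom c) (\<lambda>x. X (cinv c x) c))}"

definition field_deriv ::
  "('a, 'e::euclidean_space) manifold \<Rightarrow> ('a \<Rightarrow> ('a, 'e) tvec) \<Rightarrow> ('a \<Rightarrow> real) \<Rightarrow> 'a \<Rightarrow> real" where
  "field_deriv M X f p =
     (let c = chart_around M p in frechet_derivative (f \<circ> cinv c) (at (cmap c p)) (X p c))"

definition field_bracket ::
  "('a, 'e::euclidean_space) manifold \<Rightarrow> ('a \<Rightarrow> ('a, 'e) tvec) \<Rightarrow> ('a \<Rightarrow> ('a, 'e) tvec)
   \<Rightarrow> 'a \<Rightarrow> ('a, 'e) tvec" where
  "field_bracket M X Y p =
     (\<lambda>c. if c \<in> charts_at M p
          then frechet_derivative (\<lambda>x. Y (cinv c x) c) (at (cmap c p)) (X p c)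
             - frechet_derivative (\<lambda>x. X (cinv c x) c) (at (cmap c p)) (Y p c)
          else 0)"

definition push_field ::
  "('a, 'e::euclidean_space) manifold \<Rightarrow> ('a \<Rightarrow> 'a) \<Rightarrow> ('a \<Rightarrow> ('a, 'e) tvec)
   \<Rightarrow> 'a \<Rightarrow> ('a, 'e) tvec" where
  "push_field M f X q =
     (if q \<in> points M
      then let p = inv_into (points M) f q in tangent_map M M f p (X p) else 0)"

section \<open>Affine symmetric spaces\<close>

definition affine_connection ::
  "('a, 'e::euclidean_space) manifold
   \<Rightarrow> (('a \<Rightarrow> ('a, 'e) tvec) \<Rightarrow> ('a \<Rightarrow> ('a, 'e) tvec) \<Rightarrow> ('a \<Rightarrow> ('a, 'e) tvec)) \<Rightarrow> bool" where
  "affine_connection M nabla \<longleftrightarrow>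
     (\<forall>X\<in>vector_fields M. \<forall>Y\<in>vector_fields M. nabla X Y \<in> vector_fields M) \<and>
     (\<forall>X\<in>vector_fields M. \<forall>X'\<in>vector_fields M. \<forall>Y\<in>vector_fields M.
        nabla (X + X') Y = nabla X Y + nabla X' Y) \<and>
     (\<forall>X\<in>vector_fields M. \<forall>Y\<in>vector_fields M. \<forall>Y'\<in>vector_fields M.
        nabla X (Y + Y') = nabla X Y + nabla X Y') \<and>
     (\<forall>f. smooth_function M f \<longrightarrow> (\<forall>X\<in>vector_fields M. \<forall>Y\<in>vector_fields M.
        nabla (\<lambda>p. f p *\<^sub>R X p) Y = (\<lambda>p. f p *\<^sub>R nabla X Y p) \<and>
        nabla X (\<lambda>p. f p *\<^sub>R Y p) =
          (\<lambda>p. field_deriv M X f p *\<^sub>R Y p + f p *\<^sub>R nabla X Y p)))"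

definition affine_transformation ::
  "('a, 'e::euclidean_space) manifold
   \<Rightarrow> (('a \<Rightarrow> ('a, 'e) tvec) \<Rightarrow> ('a \<Rightarrow> ('a, 'e) tvec) \<Rightarrow> ('a \<Rightarrow> ('a, 'e) tvec))
   \<Rightarrow> ('a \<Rightarrow> 'a) \<Rightarrow> bool" where
  "affine_transformation M nabla f \<longleftrightarrow>
     diffeomorphism M M f \<and>
     (\<forall>X\<in>vector_fields M. \<forall>Y\<in>vector_fields M.
        push_field M f (nabla X Y) = nabla (push_field M f X) (push_field M f Y))"

definition infinitesimal_reflection ::
  "('a, 'e::euclidean_space) manifold \<Rightarrow> 'a \<Rightarrow> ('a \<Rightarrow> 'a) \<Rightarrow> bool" where
  "infinitesimal_reflection M x s \<longleftrightarrow>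
     diffeomorphism M M s \<and> s x = x \<and> (\<forall>v\<in>tangent_space M x. tangent_map M M s x v = - v)"

definition affine_symmetric_space ::
  "('a, 'e::euclidean_space) manifold \<Rightarrow> ('a \<times> 'a \<Rightarrow> 'a) \<Rightarrow> bool" where
  "affine_symmetric_space M S \<longleftrightarrow>
     smooth_manifold M \<and>
     (\<exists>nabla. affine_connection M nabla \<and>
        (\<forall>x\<in>points M. infinitesimal_reflection M x (\<lambda>y. S (x, y)) \<and>
           affine_transformation M nabla (\<lambda>y. S (x, y))))"

section \<open>Lie groups and their Lie algebras\<close>

definition lie_group ::
  "('g, 'z) monoid_scheme \<Rightarrow> ('g, 'h::euclidean_space) manifold \<Rightarrow> bool" where
  "lie_group G LG \<longleftrightarrow>
     group G \<and> smooth_manifold LG \<and> points LG = carrier G \<and>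
     smooth_map (prod_manifold LG LG) LG (\<lambda>(g, h). g \<otimes>\<^bsub>G\<^esub> h) \<and>
     smooth_map LG LG (\<lambda>g. inv\<^bsub>G\<^esub> g)"

definition lie_alg ::
  "('g, 'z) monoid_scheme \<Rightarrow> ('g, 'h::euclidean_space) manifold \<Rightarrow> ('g, 'h) tvec set" where
  "lie_alg G LG = tangent_space LG \<one>\<^bsub>G\<^esub>"

definition left_invariant_field ::
  "('g, 'z) monoid_scheme \<Rightarrow> ('g, 'h::euclidean_space) manifold \<Rightarrow> ('g, 'h) tvec
   \<Rightarrow> 'g \<Rightarrow> ('g, 'h) tvec" where
  "left_invariant_field G LG v g =
     (if g \<in> carrier G then tangent_map LG LG (\<lambda>h. g \<otimes>\<^bsub>G\<^esub> h) \<one>\<^bsub>G\<^esub> v else 0)"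

definition lie_bracket ::
  "('g, 'z) monoid_scheme \<Rightarrow> ('g, 'h::euclidean_space) manifold
   \<Rightarrow> ('g, 'h) tvec \<Rightarrow> ('g, 'h) tvec \<Rightarrow> ('g, 'h) tvec" where
  "lie_bracket G LG v w =
     field_bracket LG (left_invariant_field G LG v) (left_invariant_field G LG w) \<one>\<^bsub>G\<^esub>"

definition Ad ::
  "('g, 'z) monoid_scheme \<Rightarrow> ('g, 'h::euclidean_space) manifold \<Rightarrow> 'g
   \<Rightarrow> ('g, 'h) tvec \<Rightarrow> ('g, 'h) tvec" where
  "Ad G LG g v = tangent_map LG LG (\<lambda>h. g \<otimes>\<^bsub>G\<^esub> h \<otimes>\<^bsub>G\<^esub> inv\<^bsub>G\<^esub> g) \<one>\<^bsub>G\<^esub> v"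

definition lie_ideal :: "'v::real_vector set \<Rightarrow> ('v \<Rightarrow> 'v \<Rightarrow> 'v) \<Rightarrow> 'v set \<Rightarrow> bool" where
  "lie_ideal L br I \<longleftrightarrow> subspace I \<and> I \<subseteq> L \<and> (\<forall>x\<in>L. \<forall>y\<in>I. br x y \<in> I)"

definition derived_algebra :: "('v \<Rightarrow> 'v \<Rightarrow> 'v) \<Rightarrow> 'v::real_vector set \<Rightarrow> 'v set" where
  "derived_algebra br J = span {br x y | x y. x \<in> J \<and> y \<in> J}"

definition solvable_algebra :: "('v \<Rightarrow> 'v \<Rightarrow> 'v) \<Rightarrow> 'v::real_vector set \<Rightarrow> bool" where
  "solvable_algebra br J \<longleftrightarrow> (\<exists>n. (derived_algebra br ^^ n) J = {0})"

definition semisimple_algebra :: "'v::real_vector set \<Rightarrow> ('v \<Rightarrow> 'v \<Rightarrow> 'v) \<Rightarrow> bool" where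
  "semisimple_algebra L br \<longleftrightarrow>
     (\<forall>I. lie_ideal L br I \<and> solvable_algebra br I \<longrightarrow> I = {0})"

definition one_grading ::
  "'v::real_vector set \<Rightarrow> ('v \<Rightarrow> 'v \<Rightarrow> 'v) \<Rightarrow> (int \<Rightarrow> 'v set) \<Rightarrow> bool" where
  "one_grading L br gr \<longleftrightarrow>
     (\<forall>i. subspace (gr i)) \<and> (\<forall>i. \<bar>i\<bar> > 1 \<longrightarrow> gr i = {0}) \<and>
     L = {a + b + c | a b c. a \<in> gr (-1) \<and> b \<in> gr 0 \<and> c \<in> gr 1} \<and>
     (\<forall>a\<in>gr (-1). \<forall>b\<in>gr 0. \<forall>c\<in>gr 1. a + b + c = 0 \<longrightarrow> a = 0 \<and> b = 0 \<and> c = 0) \<and>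
     (\<forall>i j. \<forall>x\<in>gr i. \<forall>y\<in>gr j. br x y \<in> gr (i + j))"

definition filtration :: "(int \<Rightarrow> 'v::real_vector set) \<Rightarrow> int \<Rightarrow> 'v set" where
  "filtration gr i = span (\<Union>j\<in>{i..}. gr j)"

definition parabolic_subgroup ::
  "('g, 'z) monoid_scheme \<Rightarrow> ('g, 'h::euclidean_space) manifold \<Rightarrow> (int \<Rightarrow> ('g, 'h) tvec set)
   \<Rightarrow> 'g set" where
  "parabolic_subgroup G LG gr =
     {g \<in> carrier G. \<forall>i. Ad G LG g ` filtration gr i \<subseteq> filtration gr i}"

definition embedded_submanifold ::
  "('a, 'f::euclidean_space) manifold \<Rightarrow> ('a, 'e::euclidean_space) manifold \<Rightarrow> bool" where
  "embedded_submanifold N M \<longleftrightarrow>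
     smooth_manifold N \<and> points N \<subseteq> points M \<and> mtop N = subtopology (mtop M) (points N) \<and>
     smooth_map N M (\<lambda>p. p) \<and>
     (\<forall>p\<in>points N. inj_on (tangent_map N M (\<lambda>q. q) p) (tangent_space N p))"

section \<open>Principal bundles and Cartan connections\<close>

definition principal_bundle ::
  "('g, 'z) monoid_scheme \<Rightarrow> ('g, 'p::euclidean_space) manifold
   \<Rightarrow> ('u, 'k::euclidean_space) manifold \<Rightarrow> ('a, 'e::euclidean_space) manifold
   \<Rightarrow> ('u \<Rightarrow> 'a) \<Rightarrow> ('u \<Rightarrow> 'g \<Rightarrow> 'u) \<Rightarrow> bool" where
  "principal_bundle P LP E M proj act \<longleftrightarrow>
     lie_group P LP \<and> smooth_manifold E \<and> smooth_manifold M \<and>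
     smooth_map E M proj \<and>
     smooth_map (prod_manifold E LP) E (\<lambda>(u, p). act u p) \<and>
     (\<forall>u\<in>points E. act u \<one>\<^bsub>P\<^esub> = u) \<and>
     (\<forall>u\<in>points E. \<forall>p\<in>carrier P. \<forall>q\<in>carrier P. act (act u p) q = act u (p \<otimes>\<^bsub>P\<^esub> q)) \<and>
     (\<forall>x\<in>points M. \<exists>U Phi. openin (mtop M) U \<and> x \<in> U \<and>
        diffeomorphism (prod_manifold (open_submanifold M U) LP)
          (open_submanifold E {u \<in> points E. proj u \<in> U}) Phi \<and>
        (\<forall>y\<in>U. \<forall>p\<in>carrier P. proj (Phi (y, p)) = y \<and>
           (\<forall>q\<in>carrier P. Phi (y, p \<otimes>\<^bsub>P\<^esub> q) = act (Phi (y, p)) q)))"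

text \<open>The fundamental vector field generated by \<open>A\<close> in the Lie algebra of the structure group has
  the value \<open>T(p \<mapsto> u \<cdot> p)(A)\<close> at \<open>u\<close>; \<open>A\<close> is regarded as an element of the Lie algebra of \<open>G\<close> by
  means of the tangent map of the inclusion. Smoothness of \<open>\<omega>\<close> is tested on the local frames given
  by the coordinate vector fields, in the linear coordinates on the Lie algebra of \<open>G\<close> provided
  by charts.\<close>

definition cartan_connection ::
  "('g, 'z) monoid_scheme \<Rightarrow> ('g, 'h::euclidean_space) manifold
   \<Rightarrow> ('g, 'z) monoid_scheme \<Rightarrow> ('g, 'p::euclidean_space) manifold
   \<Rightarrow> ('u, 'k::euclidean_space) manifold \<Rightarrow> ('u \<Rightarrow> 'g \<Rightarrow> 'u)
   \<Rightarrow> ('u \<Rightarrow> ('u, 'k) tvec \<Rightarrow> ('g, 'h) tvec) \<Rightarrow> bool" where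
  "cartan_connection G LG P LP E act omega \<longleftrightarrow>
     (\<forall>u\<in>points E. \<forall>v\<in>tangent_space E u. \<forall>w\<in>tangent_space E u. \<forall>r.
        omega u (v + w) = omega u v + omega u w \<and> omega u (r *\<^sub>R v) = r *\<^sub>R omega u v) \<and>
     (\<forall>c\<in>atlas E. \<forall>w. \<forall>d\<in>charts_at LG \<one>\<^bsub>G\<^esub>.
        smooth_on (cmap c ` cdom c) (\<lambda>x. omega (cinv c x) (coord_vector E c w (cinv c x)) d)) \<and>
     (\<forall>u\<in>points E. bij_betw (omega u) (tangent_space E u) (lie_alg G LG)) \<and>
     (\<forall>u\<in>points E. \<forall>p\<in>carrier P. \<forall>v\<in>tangent_space E u.
        omega (act u p) (tangent_map E E (\<lambda>u. act u p) u v) = Ad G LG (inv\<^bsub>G\<^esub> p) (omega u v)) \<and>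
     (\<forall>u\<in>points E. \<forall>A\<in>lie_alg P LP.
        omega u (tangent_map LP E (\<lambda>p. act u p) \<one>\<^bsub>P\<^esub> A) = tangent_map LP LG (\<lambda>p. p) \<one>\<^bsub>P\<^esub> A)"

text \<open>The smooth structure \<open>LP\<close> of the closed subgroup \<open>P\<close> is the one of an embedded
  submanifold of \<open>G\<close>, which determines it uniquely.\<close>

definition one_graded_parabolic_geometry ::
  "('g, 'z) monoid_scheme \<Rightarrow> ('g, 'h::euclidean_space) manifold \<Rightarrow> (int \<Rightarrow> ('g, 'h) tvec set)
   \<Rightarrow> ('g, 'p::euclidean_space) manifold
   \<Rightarrow> ('u, 'k::euclidean_space) manifold \<Rightarrow> ('a, 'e::euclidean_space) manifold
   \<Rightarrow> ('u \<Rightarrow> 'a) \<Rightarrow> ('u \<Rightarrow> 'g \<Rightarrow> 'u)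
   \<Rightarrow> ('u \<Rightarrow> ('u, 'k) tvec \<Rightarrow> ('g, 'h) tvec) \<Rightarrow> bool" where
  "one_graded_parabolic_geometry G LG gr LP E M proj act omega \<longleftrightarrow>
     (let P = G\<lparr>carrier := parabolic_subgroup G LG gr\<rparr> in
        lie_group G LG \<and>
        semisimple_algebra (lie_alg G LG) (lie_bracket G LG) \<and>
        one_grading (lie_alg G LG) (lie_bracket G LG) gr \<and>
        embedded_submanifold LP LG \<and>
        principal_bundle P LP E M proj act \<and>
        cartan_connection G LG P LP E act omega)"

definition effective_type :: "('g, 'z) monoid_scheme \<Rightarrow> 'g set \<Rightarrow> bool" where
  "effective_type G P \<longleftrightarrow> (\<forall>N. N \<lhd> G \<and> N \<subseteq> P \<longrightarrow> N = {\<one>\<^bsub>G\<^esub>})"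

definition geometry_automorphism ::
  "'g set \<Rightarrow> ('u, 'k::euclidean_space) manifold \<Rightarrow> ('u \<Rightarrow> 'g \<Rightarrow> 'u)
   \<Rightarrow> ('u \<Rightarrow> ('u, 'k) tvec \<Rightarrow> ('g, 'h) tvec) \<Rightarrow> ('u \<Rightarrow> 'u) \<Rightarrow> bool" where
  "geometry_automorphism P E act omega phi \<longleftrightarrow>
     diffeomorphism E E phi \<and>
     (\<forall>u\<in>points E. \<forall>p\<in>P. phi (act u p) = act (phi u) p) \<and>
     (\<forall>u\<in>points E. \<forall>v\<in>tangent_space E u. omega (phi u) (tangent_map E E phi u v) = omega u v)"

definition symmetry_at ::
  "'g set \<Rightarrow> ('u, 'k::euclidean_space) manifold \<Rightarrow> ('a, 'e::euclidean_space) manifold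
   \<Rightarrow> ('u \<Rightarrow> 'a) \<Rightarrow> ('u \<Rightarrow> 'g \<Rightarrow> 'u) \<Rightarrow> ('u \<Rightarrow> ('u, 'k) tvec \<Rightarrow> ('g, 'h) tvec)
   \<Rightarrow> 'a \<Rightarrow> ('a \<Rightarrow> 'a) \<Rightarrow> bool" where
  "symmetry_at P E M proj act omega x s \<longleftrightarrow>
     infinitesimal_reflection M x s \<and>
     (\<exists>phi. geometry_automorphism P E act omega phi \<and>
        (\<forall>u\<in>points E. proj (phi u) = s (proj u)))"

definition smooth_system_of_symmetries ::
  "'g set \<Rightarrow> ('u, 'k::euclidean_space) manifold \<Rightarrow> ('a, 'e::euclidean_space) manifold
   \<Rightarrow> ('u \<Rightarrow> 'a) \<Rightarrow> ('u \<Rightarrow> 'g \<Rightarrow> 'u) \<Rightarrow> ('u \<Rightarrow> ('u, 'k) tvec \<Rightarrow> ('g, 'h) tvec)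
   \<Rightarrow> ('a \<times> 'a \<Rightarrow> 'a) \<Rightarrow> bool" where
  "smooth_system_of_symmetries P E M proj act omega S \<longleftrightarrow>
     smooth_map (prod_manifold M M) M S \<and>
     (\<forall>x\<in>points M. symmetry_at P E M proj act omega x (\<lambda>y. S (x, y)))"

end

theory Submission
  imports Defs
begin

text \<open>The symmetries themselves determine the connection. Putting \<open>y = x\<close> in
  \<open>s\<^sub>x \<circ> s\<^sub>y \<circ> s\<^sub>x = s\<^bsub>s\<^sub>x(y)\<^esub>\<close> shows that the diffeomorphism \<open>s\<^sub>x\<close> is an involution, and then the law says that
  every \<open>s\<^sub>x\<close> is an automorphism of the product \<open>S\<close>, that is, \<open>s\<^sub>x(S(y, z)) = S(s\<^sub>x(y), s\<^sub>x(z))\<close>. It therefore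
  suffices to attach to \<open>S\<close> an affine connection by a construction that is natural under
  automorphisms of \<open>S\<close>.

  At each point \<open>p\<close>, the condition \<open>T\<^sub>p s\<^sub>p = -id\<close> allows only one Christoffel form which \<open>s\<^sub>p\<close> preserves at \<open>p\<close>,
  namely \<open>- D\<^sup>2s\<^sub>p(p)/2\<close>. Taking it at every \<open>p\<close> gives the connection of Loos. The lemma
  \<open>reflection_connection_natural\<close> is the computation in Euclidean space showing that the resulting
  expression is carried along by any map that intertwines two reflections. On the manifold it becomes
  \<open>nabla_natural\<close>, which for the identity map says that the expression does not depend on charts
  (\<open>nabla_tangent\<close>) and for the map \<open>s\<^sub>x\<close> says that \<open>s\<^sub>x\<close> is affine (\<open>nabla_sym_affine\<close>). Smooth dependence
  on \<open>p\<close> (\<open>nabla_smooth\<close>) comes from the smoothness of \<open>S\<close> in both variables jointly.\<close>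

section \<open>Calculus of smooth maps\<close>

lemma frechet_derivative_eventually_cong:
  assumes "f differentiable (at x)" and "\<forall>\<^sub>F y in nhds x. f y = g y"
  shows "g differentiable (at x)" "frechet_derivative g (at x) = frechet_derivative f (at x)"
proof -
  have "(f has_derivative frechet_derivative f (at x)) (at x)"
    using assms(1) by (simp add: frechet_derivative_works)
  then have "(g has_derivative frechet_derivative f (at x)) (at x)"
    by (rule has_derivative_transform_eventually)
      (use assms(2) eventually_nhds_x_imp_x in \<open>auto simp: eventually_at_filter elim: eventually_mono\<close>)
  then show "g differentiable (at x)" "frechet_derivative g (at x) = frechet_derivative f (at x)"
    by (auto simp: differentiable_def dest: frechet_derivative_at)
qed

lemma frechet_derivative_open_cong:
  assumes "f differentiable (at x)" "open S" "x \<in> S" "\<And>y. y \<in> S \<Longrightarrow> f y = g y"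
  shows "g differentiable (at x)" "frechet_derivative g (at x) = frechet_derivative f (at x)"
  using frechet_derivative_eventually_cong[OF assms(1)] assms(2-4)
  by (auto simp: eventually_nhds)

lemma Ck_on_cong:
  assumes "open S" "\<And>x. x \<in> S \<Longrightarrow> f x = g x" "Ck_on k S f"
  shows "Ck_on k S g"
  using assms(2,3)
proof (induction k arbitrary: f g)
  case 0
  then show ?case by (auto cong: continuous_on_cong)
next
  case (Suc k)
  have eq: "g differentiable (at x)" "frechet_derivative f (at x) = frechet_derivative g (at x)"
    if "x \<in> S" for x
    using frechet_derivative_open_cong[OF _ assms(1) that, of f g] Suc.prems that by auto
  have "Ck_on k S (\<lambda>x. frechet_derivative g (at x) v)" for v
    by (rule Suc.IH[of "\<lambda>x. frechet_derivative f (at x) v"]) (use Suc.prems eq in auto)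
  with eq show ?case by auto
qed

lemma Ck_on_Suc_imp: "Ck_on (Suc k) S f \<Longrightarrow> Ck_on k S f"
proof (induction k arbitrary: f)
  case 0
  then show ?case
    by (auto intro!: continuous_at_imp_continuous_on differentiable_imp_continuous_within)
qed auto

text \<open>In the inductions on the order of smoothness below, the derivative of the map at hand is computed
  by a rule for \<^const>\<open>has_derivative\<close> and fed into this rule; every direction of that derivative is
  then built from maps to which the induction hypothesis applies.\<close>

lemma Ck_on_SucI:
  assumes "open S" "\<And>x. x \<in> S \<Longrightarrow> (f has_derivative f' x) (at x)"
    and "\<And>v. Ck_on k S (\<lambda>x. f' x v)"
  shows "Ck_on (Suc k) S f"
proof -
  have "Ck_on k S (\<lambda>x. frechet_derivative f (at x) v)" for v
    by (rule Ck_on_cong[OF assms(1) _ assms(3)[of v]]) (simp add: frechet_derivative_at[OF assms(2)])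
  then show ?thesis
    using assms(2) by (auto simp: differentiable_def)
qed

lemma Ck_on_Suc_has_derivative:
  "Ck_on (Suc k) S f \<Longrightarrow> x \<in> S \<Longrightarrow> (f has_derivative frechet_derivative f (at x)) (at x)"
  by (simp add: frechet_derivative_works)

lemma Ck_on_const: "open S \<Longrightarrow> Ck_on k S (\<lambda>x. c)"
proof (induction k arbitrary: c)
  case (Suc k)
  show ?case
    by (rule Ck_on_SucI[where f' = "\<lambda>x v. 0"]) (use Suc in auto)
qed auto

lemma Ck_on_bounded_linear:
  assumes "bounded_linear h" "open S" "Ck_on k S f"
  shows "Ck_on k S (\<lambda>x. h (f x))"
  using assms(3)
proof (induction k arbitrary: f)
  case 0
  then show ?case
    using linear_continuous_on[OF assms(1), of UNIV] by (auto intro: continuous_on_compose2)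
next
  case (Suc k)
  show ?case
    by (rule Ck_on_SucI[OF assms(2) bounded_linear.has_derivative[OF assms(1)
          Ck_on_Suc_has_derivative[OF Suc.prems]]]) (use Suc in auto)
qed

lemma Ck_on_id: "open S \<Longrightarrow> Ck_on k S (\<lambda>x. x)"
proof (cases k)
  case (Suc n)
  assume "open S"
  then show ?thesis unfolding Suc
    by (intro Ck_on_SucI[where f' = "\<lambda>x v. v"]) (auto intro: Ck_on_const)
qed auto

lemma Ck_on_add:
  assumes "open S" "Ck_on k S f" "Ck_on k S g"
  shows "Ck_on k S (\<lambda>x. f x + g x)"
  using assms(2,3)
proof (induction k arbitrary: f g)
  case 0
  then show ?case by (auto intro: continuous_intros)
next
  case (Suc k)
  show ?case
    by (rule Ck_on_SucI[OF assms(1) has_derivative_add[OF Ck_on_Suc_has_derivative[OF Suc.prems(1)]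
          Ck_on_Suc_has_derivative[OF Suc.prems(2)]]]) (use Suc in auto)
qed

lemma Ck_on_sum:
  assumes "open S" "finite I" "\<And>i. i \<in> I \<Longrightarrow> Ck_on k S (f i)"
  shows "Ck_on k S (\<lambda>x. \<Sum>i\<in>I. f i x)"
  using assms(2,3) by (induction I) (auto simp: Ck_on_const Ck_on_add assms(1))

lemma Ck_on_scaleR:
  assumes "open S" "Ck_on k S f" "Ck_on k S g"
  shows "Ck_on k S (\<lambda>x. f x *\<^sub>R g x)"
  using assms(2,3)
proof (induction k arbitrary: f g)
  case 0
  then show ?case by (auto intro: continuous_intros)
next
  case (Suc k)
  show ?case
    by (rule Ck_on_SucI[OF assms(1) has_derivative_scaleR[OF Ck_on_Suc_has_derivative[OF Suc.prems(1)]
          Ck_on_Suc_has_derivative[OF Suc.prems(2)]]])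
      (use Suc Ck_on_Suc_imp[OF Suc.prems(1)] Ck_on_Suc_imp[OF Suc.prems(2)] in
        \<open>auto intro!: Ck_on_add assms(1)\<close>)
qed

text \<open>Smoothness speaks of derivatives in constant directions only. Expanding in a basis is what
  gives access to a direction that varies with the point, as in the chain rule or in the derivative
  along a vector field.\<close>

lemma linear_euclidean_expansion:
  fixes h :: "'a::euclidean_space \<Rightarrow> 'b::real_vector"
  assumes "linear h"
  shows "h w = (\<Sum>i\<in>Basis. (w \<bullet> i) *\<^sub>R h i)"
proof -
  have "h w = h (\<Sum>i\<in>Basis. (w \<bullet> i) *\<^sub>R i)" by (simp add: euclidean_representation)
  also have "\<dots> = (\<Sum>i\<in>Basis. (w \<bullet> i) *\<^sub>R h i)"
    using assms by (simp add: linear_sum linear_scale)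
  finally show ?thesis .
qed

lemma Ck_on_compose:
  fixes g :: "'a::real_normed_vector \<Rightarrow> 'b::euclidean_space"
  assumes "open S" "open T" "g ` S \<subseteq> T" "Ck_on k S g" "Ck_on k T f"
  shows "Ck_on k S (\<lambda>x. f (g x))"
  using assms(3-5)
proof (induction k arbitrary: f g)
  case 0
  then show ?case by (auto intro: continuous_on_compose2)
next
  case (Suc k)
  let ?D = frechet_derivative
  have lin: "linear (?D f (at (g x)))" if "x \<in> S" for x
    using Suc.prems that by (auto intro!: linear_frechet_derivative)
  have der: "((\<lambda>x. f (g x)) has_derivative (\<lambda>v. ?D f (at (g x)) (?D g (at x) v))) (at x)"
    if "x \<in> S" for x
    by (rule has_derivative_compose[OF Ck_on_Suc_has_derivative[OF Suc.prems(2) that]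
          Ck_on_Suc_has_derivative[OF Suc.prems(3)]])
      (use that Suc.prems in auto)
  have inner: "Ck_on k S (\<lambda>x. ?D g (at x) v \<bullet> i)" for v i
    by (rule Ck_on_bounded_linear[OF bounded_linear_inner_left assms(1)]) (use Suc.prems in auto)
  have "Ck_on k S (\<lambda>x. \<Sum>i\<in>Basis. (?D g (at x) v \<bullet> i) *\<^sub>R ?D f (at (g x)) i)" for v
    by (intro Ck_on_sum Ck_on_scaleR assms(1) inner Suc.IH Ck_on_Suc_imp[OF Suc.prems(2)] Suc.prems(1))
      (use Suc.prems(3) in auto)
  then have "Ck_on k S (\<lambda>x. ?D f (at (g x)) (?D g (at x) v))" for v
    by (rule Ck_on_cong[OF assms(1), rotated]) (rule linear_euclidean_expansion[OF lin, symmetric])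
  from Ck_on_SucI[OF assms(1) der this] show ?case .
qed

lemma smooth_on_open: "smooth_on S f \<Longrightarrow> open S"
  by (simp add: smooth_on_def)

lemma smooth_on_differentiable: "smooth_on S f \<Longrightarrow> x \<in> S \<Longrightarrow> f differentiable (at x)"
  unfolding smooth_on_def by (metis Ck_on.simps(2))

lemma smooth_on_has_derivative:
  "smooth_on S f \<Longrightarrow> x \<in> S \<Longrightarrow> (f has_derivative frechet_derivative f (at x)) (at x)"
  using smooth_on_differentiable frechet_derivative_works by blast

lemma smooth_on_linear: "smooth_on S f \<Longrightarrow> x \<in> S \<Longrightarrow> linear (frechet_derivative f (at x))"
  using smooth_on_differentiable linear_frechet_derivative by blast

lemma smooth_on_cong: "(\<And>x. x \<in> S \<Longrightarrow> f x = g x) \<Longrightarrow> smooth_on S f \<Longrightarrow> smooth_on S g"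
  unfolding smooth_on_def using Ck_on_cong by metis

lemma smooth_on_directional:
  "smooth_on S f \<Longrightarrow> smooth_on S (\<lambda>x. frechet_derivative f (at x) v)"
  unfolding smooth_on_def by (metis Ck_on.simps(2))

lemma smooth_on_bounded_linear:
  "bounded_linear h \<Longrightarrow> smooth_on S f \<Longrightarrow> smooth_on S (\<lambda>x. h (f x))"
  unfolding smooth_on_def using Ck_on_bounded_linear by blast

lemma smooth_on_id: "open S \<Longrightarrow> smooth_on S (\<lambda>x. x)"
  unfolding smooth_on_def using Ck_on_id by blast

lemma smooth_on_add: "smooth_on S f \<Longrightarrow> smooth_on S g \<Longrightarrow> smooth_on S (\<lambda>x. f x + g x)"
  unfolding smooth_on_def using Ck_on_add by blast

lemma smooth_on_compose:
  fixes g :: "'a::real_normed_vector \<Rightarrow> 'b::euclidean_space"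
  shows "smooth_on S g \<Longrightarrow> smooth_on T f \<Longrightarrow> g ` S \<subseteq> T \<Longrightarrow> smooth_on S (\<lambda>x. f (g x))"
  unfolding smooth_on_def using Ck_on_compose by blast

lemma smooth_on_derivative_along:
  fixes f :: "'a::euclidean_space \<Rightarrow> 'b::real_normed_vector"
  assumes "smooth_on S f" "smooth_on S v"
  shows "smooth_on S (\<lambda>x. frechet_derivative f (at x) (v x))"
proof -
  have "smooth_on S (\<lambda>x. \<Sum>i\<in>Basis. (v x \<bullet> i) *\<^sub>R frechet_derivative f (at x) i)"
    using assms(1) smooth_on_directional[OF assms(1)]
      smooth_on_bounded_linear[OF bounded_linear_inner_left assms(2)]
    unfolding smooth_on_def by (auto intro!: Ck_on_sum Ck_on_scaleR)
  then show ?thesis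
    by (rule smooth_on_cong[rotated])
      (rule linear_euclidean_expansion[OF smooth_on_linear[OF assms(1)], symmetric])
qed

section \<open>Second derivatives and the local form of the connection\<close>

text \<open>The bilinear form \<open>D\<^sup>2f(x)\<close>, built from iterated directional derivatives because smoothness is
  defined by these.\<close>

definition second_deriv :: "('a::real_normed_vector \<Rightarrow> 'b::real_normed_vector) \<Rightarrow> 'a \<Rightarrow> 'a \<Rightarrow> 'a \<Rightarrow> 'b" where
  "second_deriv f x u w = frechet_derivative (\<lambda>z. frechet_derivative f (at z) w) (at x) u"

text \<open>Linearity of the second derivative in its inner direction is not immediate from the definition, since
  that direction sits under the outer derivative; the expansion of the first derivative in a basis
  brings it outside.\<close>

lemma second_derivative_expansion:
  fixes f :: "'a::euclidean_space \<Rightarrow> 'b::real_normed_vector"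
  assumes "smooth_on S f" "x \<in> S"
  shows "((\<lambda>z. frechet_derivative f (at z) w) has_derivative
           (\<lambda>u. \<Sum>i\<in>Basis. (w \<bullet> i) *\<^sub>R
             frechet_derivative (\<lambda>z. frechet_derivative f (at z) i) (at x) u)) (at x)"
proof -
  let ?D = frechet_derivative
  have "((\<lambda>z. \<Sum>i\<in>Basis. (w \<bullet> i) *\<^sub>R ?D f (at z) i) has_derivative
      (\<lambda>u. \<Sum>i\<in>Basis. (w \<bullet> i) *\<^sub>R ?D (\<lambda>z. ?D f (at z) i) (at x) u)) (at x)"
    by (intro has_derivative_sum has_derivative_scaleR_right
        smooth_on_has_derivative[OF smooth_on_directional[OF assms(1)] assms(2)])
  then show ?thesis
    by (rule has_derivative_transform_within_open[OF _ smooth_on_open[OF assms(1)] assms(2)])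
      (rule linear_euclidean_expansion[OF smooth_on_linear[OF assms(1)], symmetric])
qed

lemma second_deriv_expansion:
  fixes f :: "'a::euclidean_space \<Rightarrow> 'b::real_normed_vector"
  assumes "smooth_on S f" "x \<in> S"
  shows "second_deriv f x u w = (\<Sum>i\<in>Basis. (w \<bullet> i) *\<^sub>R second_deriv f x u i)"
  unfolding second_deriv_def
  by (rule fun_cong[OF frechet_derivative_at[OF second_derivative_expansion[OF assms]], symmetric])

lemma second_deriv_linear_left:
  assumes "smooth_on S f" "x \<in> S"
  shows "linear (\<lambda>u. second_deriv f x u w)"
  unfolding second_deriv_def by (rule smooth_on_linear[OF smooth_on_directional[OF assms(1)] assms(2)])

lemma second_deriv_linear_right:
  fixes f :: "'a::euclidean_space \<Rightarrow> 'b::real_normed_vector"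
  assumes "smooth_on S f" "x \<in> S"
  shows "linear (second_deriv f x u)"
proof (rule linearI)
  show "second_deriv f x u (v + w) = second_deriv f x u v + second_deriv f x u w" for v w
    unfolding second_deriv_expansion[OF assms, of u v] second_deriv_expansion[OF assms, of u w]
      second_deriv_expansion[OF assms, of u "v + w"]
    by (simp add: inner_add_left scaleR_add_left sum.distrib)
  show "second_deriv f x u (r *\<^sub>R w) = r *\<^sub>R second_deriv f x u w" for r w
    unfolding second_deriv_expansion[OF assms, of u w] second_deriv_expansion[OF assms, of u "r *\<^sub>R w"]
    by (simp add: scaleR_sum_right)
qed

text \<open>The product rule for \<open>DF(g x)(v x)\<close> with moving base point and moving direction. Both the chain
  rule of second order and the derivative of a pushed forward vector field are instances.\<close>

lemma has_derivative_derivative_along: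
  fixes F :: "'b::euclidean_space \<Rightarrow> 'c::real_normed_vector"
  assumes F: "smooth_on V F" "g a \<in> V"
    and g: "(g has_derivative g') (at a)" and v: "(v has_derivative v') (at a)"
  shows "((\<lambda>x. frechet_derivative F (at (g x)) (v x)) has_derivative
           (\<lambda>u. second_deriv F (g a) (g' u) (v a) + frechet_derivative F (at (g a)) (v' u))) (at a)"
proof -
  let ?D = frechet_derivative
  have 1: "((\<lambda>x. ?D F (at (g x)) i) has_derivative (\<lambda>u. second_deriv F (g a) (g' u) i)) (at a)" for i
    unfolding second_deriv_def
    by (rule has_derivative_compose[OF g smooth_on_has_derivative[OF smooth_on_directional[OF F(1)] F(2)]])
  have 2: "((\<lambda>x. v x \<bullet> i) has_derivative (\<lambda>u. v' u \<bullet> i)) (at a)" for i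
    by (intro has_derivative_inner_left v)
  have "((\<lambda>x. \<Sum>i\<in>Basis. (v x \<bullet> i) *\<^sub>R ?D F (at (g x)) i) has_derivative
      (\<lambda>u. \<Sum>i\<in>Basis. (v a \<bullet> i) *\<^sub>R second_deriv F (g a) (g' u) i + (v' u \<bullet> i) *\<^sub>R ?D F (at (g a)) i)) (at a)"
    by (intro has_derivative_sum has_derivative_scaleR 1 2)
  moreover have "(\<lambda>u. \<Sum>i\<in>Basis. (v a \<bullet> i) *\<^sub>R second_deriv F (g a) (g' u) i + (v' u \<bullet> i) *\<^sub>R ?D F (at (g a)) i)
      = (\<lambda>u. second_deriv F (g a) (g' u) (v a) + ?D F (at (g a)) (v' u))"
    by (subst second_deriv_expansion[OF F, of _ "v a"],
        subst linear_euclidean_expansion[OF smooth_on_linear[OF F], of "v' _"])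
      (simp add: sum.distrib)
  ultimately have "((\<lambda>x. \<Sum>i\<in>Basis. (v x \<bullet> i) *\<^sub>R ?D F (at (g x)) i) has_derivative
      (\<lambda>u. second_deriv F (g a) (g' u) (v a) + ?D F (at (g a)) (v' u))) (at a)" by simp
  moreover have ev: "\<forall>\<^sub>F x in at a. g x \<in> V"
    using has_derivative_continuous[OF g] smooth_on_open[OF F(1)] F(2)
    by (simp add: continuous_within topological_tendstoD)
  have "\<forall>\<^sub>F x in at a. (\<Sum>i\<in>Basis. (v x \<bullet> i) *\<^sub>R ?D F (at (g x)) i) = ?D F (at (g x)) (v x)"
    using ev by eventually_elim
      (rule linear_euclidean_expansion[OF smooth_on_linear[OF F(1)], symmetric])
  ultimately show ?thesis
    by (rule has_derivative_transform_eventually)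
      (auto intro: linear_euclidean_expansion[OF smooth_on_linear[OF F], symmetric])
qed

text \<open>The heart of the argument. If \<open>\<phi>\<close> intertwines \<open>\<sigma>\<close> and \<open>\<tau>\<close>, which reflect the tangent spaces at
  \<open>a\<close> and at \<open>\<phi> a\<close>, then \<open>\<phi>\<close> carries the expression \<open>Dy(u) - D\<^sup>2\<sigma>(u, y)/2\<close> at \<open>a\<close> to the
  corresponding one at \<open>\<phi> a\<close>. Pushing \<open>y\<close> forward produces the unwanted term \<open>D\<^sup>2\<phi>(u, y)\<close>. Two
  differentiations of \<open>\<tau> \<circ> \<phi> = \<phi> \<circ> \<sigma>\<close> at \<open>a\<close>, using that the first derivatives of \<open>\<sigma>\<close> and \<open>\<tau>\<close>
  there are \<open>-id\<close>, give \<open>D\<^sup>2\<tau>(D\<phi> u, D\<phi> y) = 2 D\<^sup>2\<phi>(u, y) + D\<phi>(D\<^sup>2\<sigma>(u, y))\<close>, so that half of it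
  cancels the unwanted term. Applied to coordinate changes this makes the connection well defined,
  applied to symmetries it makes it invariant.\<close>

lemma reflection_connection_natural:
  fixes \<phi> :: "'a::euclidean_space \<Rightarrow> 'b::euclidean_space"
  assumes \<phi>: "smooth_on U \<phi>" "a \<in> U"
    and \<sigma>: "smooth_on V \<sigma>" "a \<in> V" "\<sigma> a = a" "\<And>w. frechet_derivative \<sigma> (at a) w = - w"
    and \<tau>: "smooth_on W \<tau>" "\<phi> a \<in> W" "\<And>w. frechet_derivative \<tau> (at (\<phi> a)) w = - w"
    and comm: "\<And>x. x \<in> U \<Longrightarrow> x \<in> V \<Longrightarrow> \<tau> (\<phi> x) = \<phi> (\<sigma> x)"
    and y: "y differentiable (at a)" and y': "y' differentiable (at (\<phi> a))"
    and push: "\<And>x. x \<in> U \<Longrightarrow> y' (\<phi> x) = frechet_derivative \<phi> (at x) (y x)"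
  shows "frechet_derivative y' (at (\<phi> a)) (frechet_derivative \<phi> (at a) u)
           - (1/2) *\<^sub>R second_deriv \<tau> (\<phi> a) (frechet_derivative \<phi> (at a) u) (y' (\<phi> a))
         = frechet_derivative \<phi> (at a) (frechet_derivative y (at a) u - (1/2) *\<^sub>R second_deriv \<sigma> a u (y a))"
proof -
  let ?D = frechet_derivative
  let ?w = "y a" and ?T = "?D \<phi> (at a)"
  have linT: "linear ?T" using smooth_on_linear[OF \<phi>] .
  have "frechet_derivative \<sigma> (at a) = (\<lambda>u. - u)" using \<sigma>(4) by blast
  then have d\<phi>: "(\<phi> has_derivative ?T) (at a)" and d\<sigma>: "(\<sigma> has_derivative (\<lambda>u. - u)) (at a)"
    using smooth_on_has_derivative[OF \<phi>] smooth_on_has_derivative[OF \<sigma>(1,2)] by simp_all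
  have hd: "((\<lambda>x. ?D f (at x) ?w) has_derivative (\<lambda>u. second_deriv f a u ?w)) (at a)"
    if "smooth_on S f" "a \<in> S" for S and f :: "'a \<Rightarrow> 'c::euclidean_space"
    unfolding second_deriv_def
    by (rule smooth_on_has_derivative[OF smooth_on_directional[OF that(1)] that(2)])
  \<comment> \<open>\<open>A\<close> and \<open>B\<close> differentiate the two sides of the chain rule for \<open>\<tau> \<circ> \<phi> = \<phi> \<circ> \<sigma>\<close>; that the sides
    agree near \<open>a\<close> is shown below in \<open>chain\<close>.\<close>
  have A: "((\<lambda>x. ?D \<tau> (at (\<phi> x)) (?D \<phi> (at x) ?w)) has_derivative
      (\<lambda>u. second_deriv \<tau> (\<phi> a) (?T u) (?T ?w) - second_deriv \<phi> a u ?w)) (at a)"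
    using has_derivative_derivative_along[OF \<tau>(1,2) d\<phi> hd[OF \<phi>]] \<tau>(3) by simp
  have B: "((\<lambda>x. ?D \<phi> (at (\<sigma> x)) (?D \<sigma> (at x) ?w)) has_derivative
      (\<lambda>u. second_deriv \<phi> a u ?w + ?T (second_deriv \<sigma> a u ?w))) (at a)"
    using has_derivative_derivative_along[of U \<phi> \<sigma> a, OF \<phi>(1) _ d\<sigma> hd[OF \<sigma>(1,2)]] \<phi>(2) \<sigma>(3,4)
      linear_neg[OF second_deriv_linear_left[OF \<phi>]] linear_neg[OF second_deriv_linear_right[OF \<phi>]] by simp
  have ev: "\<forall>\<^sub>F x in at a. x \<in> U \<and> x \<in> V \<and> \<phi> x \<in> W \<and> \<sigma> x \<in> U"
    using has_derivative_continuous[OF d\<phi>] has_derivative_continuous[OF d\<sigma>]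
      smooth_on_open[OF \<phi>(1)] smooth_on_open[OF \<sigma>(1)] smooth_on_open[OF \<tau>(1)] \<phi>(2) \<sigma>(2,3) \<tau>(2)
    by (intro eventually_conj) (auto simp: continuous_within topological_tendstoD eventually_at_in_open')
  have chain: "?D \<tau> (at (\<phi> x)) (?D \<phi> (at x) ?w) = ?D \<phi> (at (\<sigma> x)) (?D \<sigma> (at x) ?w)"
    if x: "x \<in> U" "x \<in> V" "\<phi> x \<in> W" "\<sigma> x \<in> U" for x
  proof -
    have "((\<lambda>x. \<tau> (\<phi> x)) has_derivative (\<lambda>v. ?D \<tau> (at (\<phi> x)) (?D \<phi> (at x) v))) (at x)"
      by (rule has_derivative_compose[OF smooth_on_has_derivative[OF \<phi>(1) x(1)]
            smooth_on_has_derivative[OF \<tau>(1) x(3)]])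
    then have 1: "((\<lambda>x. \<phi> (\<sigma> x)) has_derivative (\<lambda>v. ?D \<tau> (at (\<phi> x)) (?D \<phi> (at x) v))) (at x)"
      by (rule has_derivative_transform_within_open[of _ _ _ _ "U \<inter> V"])
        (use x comm smooth_on_open[OF \<phi>(1)] smooth_on_open[OF \<sigma>(1)] in auto)
    have "((\<lambda>x. \<phi> (\<sigma> x)) has_derivative (\<lambda>v. ?D \<phi> (at (\<sigma> x)) (?D \<sigma> (at x) v))) (at x)"
      by (rule has_derivative_compose[OF smooth_on_has_derivative[OF \<sigma>(1) x(2)]
            smooth_on_has_derivative[OF \<phi>(1) x(4)]])
    from has_derivative_unique[OF 1 this] show ?thesis by metis
  qed
  have "((\<lambda>x. ?D \<phi> (at (\<sigma> x)) (?D \<sigma> (at x) ?w)) has_derivative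
      (\<lambda>u. second_deriv \<tau> (\<phi> a) (?T u) (?T ?w) - second_deriv \<phi> a u ?w)) (at a)"
    by (rule has_derivative_transform_eventually[OF A])
      (use ev chain \<phi>(2) \<sigma>(2,3) \<tau>(2) in \<open>auto elim: eventually_mono\<close>)
  from has_derivative_unique[OF this B]
  have eq1: "second_deriv \<tau> (\<phi> a) (?T u) (?T ?w) = 2 *\<^sub>R second_deriv \<phi> a u ?w + ?T (second_deriv \<sigma> a u ?w)"
    by (metis (no_types, lifting) add.assoc diff_eq_eq add.commute scaleR_2)
  have "((\<lambda>x. y' (\<phi> x)) has_derivative (\<lambda>u. ?D y' (at (\<phi> a)) (?T u))) (at a)"
    using has_derivative_compose[OF d\<phi>] y' frechet_derivative_works by blast
  then have C: "((\<lambda>x. ?D \<phi> (at x) (y x)) has_derivative (\<lambda>u. ?D y' (at (\<phi> a)) (?T u))) (at a)"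
    by (rule has_derivative_transform_within_open[OF _ smooth_on_open[OF \<phi>(1)] \<phi>(2)])
      (use push in auto)
  have "((\<lambda>x. ?D \<phi> (at x) (y x)) has_derivative (\<lambda>u. second_deriv \<phi> a u ?w + ?T (?D y (at a) u))) (at a)"
    using has_derivative_derivative_along[of U \<phi> "\<lambda>x. x" a] \<phi> y
      frechet_derivative_works has_derivative_ident by blast
  from has_derivative_unique[OF C this]
  have eq2: "?D y' (at (\<phi> a)) (?T u) = second_deriv \<phi> a u ?w + ?T (?D y (at a) u)" by metis
  show ?thesis
    unfolding eq2 push[OF \<phi>(2)] eq1
    by (simp add: linear_diff[OF linT] linear_scale[OF linT] scaleR_add_right)
qed

section \<open>Charts and tangent maps\<close>

definition chart_rep :: "('a \<Rightarrow> 'b) \<Rightarrow> ('a, 'e) chart \<Rightarrow> ('b, 'f) chart \<Rightarrow> 'e \<Rightarrow> 'f" where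
  "chart_rep f c d x = cmap d (f (cinv c x))"

lemma charts_atD: "c \<in> charts_at M p \<Longrightarrow> c \<in> atlas M \<and> p \<in> cdom c"
  by (simp add: charts_at_def)

lemma charts_atI: "c \<in> atlas M \<Longrightarrow> p \<in> cdom c \<Longrightarrow> c \<in> charts_at M p"
  by (simp add: charts_at_def)

lemma cdom_subset: "smooth_manifold M \<Longrightarrow> c \<in> atlas M \<Longrightarrow> cdom c \<subseteq> points M"
  unfolding smooth_manifold_def by blast

lemma charts_at_points: "smooth_manifold M \<Longrightarrow> c \<in> charts_at M p \<Longrightarrow> p \<in> points M"
  using charts_atD cdom_subset by fast

lemma chart_around_in:
  assumes "smooth_manifold M" "p \<in> points M"
  shows "chart_around M p \<in> charts_at M p"
proof -
  have "\<exists>c. c \<in> charts_at M p"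
    using assms unfolding smooth_manifold_def charts_at_def by fast
  then show ?thesis
    unfolding chart_around_def by (rule someI_ex)
qed

lemma chart_inj:
  assumes "smooth_manifold M" "c \<in> atlas M"
  shows "inj_on (cmap c) (cdom c)"
proof -
  have "homeomorphic_map (subtopology (mtop M) (cdom c)) (top_of_set (cmap c ` cdom c)) (cmap c)"
    using assms unfolding smooth_manifold_def by blast
  from homeomorphic_imp_injective_map[OF this] show ?thesis
    using cdom_subset[OF assms] by (simp add: inf.absorb2)
qed

lemma cinv_cmap: "smooth_manifold M \<Longrightarrow> c \<in> atlas M \<Longrightarrow> p \<in> cdom c \<Longrightarrow> cinv c (cmap c p) = p"
  unfolding cinv_def by (rule inv_into_f_f[OF chart_inj])

lemma chart_image_open: "smooth_manifold M \<Longrightarrow> c \<in> atlas M \<Longrightarrow> open (cmap c ` cdom c)"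
  unfolding smooth_manifold_def by blast

lemma chart_rep_smooth:
  "smooth_map M N f \<Longrightarrow> c \<in> atlas M \<Longrightarrow> d \<in> atlas N \<Longrightarrow>
     smooth_on (cmap c ` (cdom c \<inter> f -` cdom d)) (chart_rep f c d)"
  unfolding smooth_map_def chart_rep_def comp_def by blast

lemma chart_rep_cmap:
  "smooth_manifold M \<Longrightarrow> c \<in> charts_at M p \<Longrightarrow> chart_rep f c d (cmap c p) = cmap d (f p)"
  by (simp add: chart_rep_def charts_at_def cinv_cmap)

lemma chart_rep_has_derivative:
  assumes "smooth_map M N f" "c \<in> charts_at M p" "d \<in> charts_at N (f p)"
  shows "(chart_rep f c d has_derivative frechet_derivative (chart_rep f c d) (at (cmap c p)))
           (at (cmap c p))"
  by (rule smooth_on_has_derivative[OF chart_rep_smooth[OF assms(1)]])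
    (use assms in \<open>auto simp: charts_at_def\<close>)

lemma smooth_map_ident: "smooth_manifold M \<Longrightarrow> smooth_map M M (\<lambda>x. x)"
  unfolding smooth_map_def smooth_manifold_def by (simp add: comp_def)

text \<open>The chain rule in charts. A name of its own for the composite keeps the rule applicable when one of
  the factors is the identity and the composite has collapsed to the other factor.\<close>

lemma chart_rep_compose:
  assumes M: "smooth_manifold M" "smooth_manifold N"
    and f: "smooth_map M N f" and g: "smooth_map N L g"
    and c: "c \<in> charts_at M p" and d: "d \<in> charts_at N (f p)" and e: "e \<in> charts_at L (g (f p))"
    and h: "\<And>q. q \<in> points M \<Longrightarrow> h q = g (f q)"
  shows "frechet_derivative (chart_rep h c e) (at (cmap c p)) w =
           frechet_derivative (chart_rep g d e) (at (cmap d (f p)))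
             (frechet_derivative (chart_rep f c d) (at (cmap c p)) w)"
proof -
  let ?D = frechet_derivative
  have c': "c \<in> atlas M" "p \<in> cdom c" and d': "d \<in> atlas N" "f p \<in> cdom d"
    using charts_atD[OF c] charts_atD[OF d] by auto
  have "((\<lambda>x. chart_rep g d e (chart_rep f c d x)) has_derivative
      (\<lambda>w. ?D (chart_rep g d e) (at (cmap d (f p))) (?D (chart_rep f c d) (at (cmap c p)) w)))
      (at (cmap c p))"
    by (rule has_derivative_compose[OF chart_rep_has_derivative[OF f c d]])
      (simp add: chart_rep_cmap[OF M(1) c] chart_rep_has_derivative[OF g d e])
  then have "(chart_rep h c e has_derivative
      (\<lambda>w. ?D (chart_rep g d e) (at (cmap d (f p))) (?D (chart_rep f c d) (at (cmap c p)) w)))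
      (at (cmap c p))"
  proof (rule has_derivative_transform_within_open)
    show "open (cmap c ` (cdom c \<inter> f -` cdom d))"
      using smooth_on_open chart_rep_smooth[OF f c'(1) d'(1)] by blast
    show "cmap c p \<in> cmap c ` (cdom c \<inter> f -` cdom d)" using c' d' by blast
    fix x assume "x \<in> cmap c ` (cdom c \<inter> f -` cdom d)"
    then show "chart_rep g d e (chart_rep f c d x) = chart_rep h c e x"
      using M c' d' h cdom_subset[OF M(1) c'(1)] by (auto simp: chart_rep_def cinv_cmap)
  qed
  from frechet_derivative_at[OF this] show ?thesis by metis
qed

lemma chart_rep_ident_derivative:
  assumes "smooth_manifold M" "c \<in> charts_at M p"
  shows "frechet_derivative (chart_rep (\<lambda>x. x) c c) (at (cmap c p)) w = w"
proof -
  have c: "c \<in> atlas M" "p \<in> cdom c" using charts_atD[OF assms(2)] by auto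
  have "(chart_rep (\<lambda>x. x) c c has_derivative (\<lambda>w. w)) (at (cmap c p))"
    by (rule has_derivative_transform_within_open[OF has_derivative_ident chart_image_open[OF assms(1) c(1)]])
      (use c assms in \<open>auto simp: chart_rep_def cinv_cmap\<close>)
  from frechet_derivative_at[OF this] show ?thesis by metis
qed

lemma tangent_space_iff:
  "v \<in> tangent_space M p \<longleftrightarrow>
     (\<forall>c\<in>charts_at M p. \<forall>d\<in>charts_at M p.
        v d = frechet_derivative (chart_rep (\<lambda>x. x) c d) (at (cmap c p)) (v c)) \<and>
     (\<forall>c. c \<notin> charts_at M p \<longrightarrow> v c = 0)"
  unfolding tangent_space_def by (simp add: comp_def chart_rep_def[abs_def])

lemma tangent_space_chart:
  "v \<in> tangent_space M p \<Longrightarrow> c \<in> charts_at M p \<Longrightarrow> d \<in> charts_at M p \<Longrightarrow>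
     v d = frechet_derivative (chart_rep (\<lambda>x. x) c d) (at (cmap c p)) (v c)"
  unfolding tangent_space_iff by blast

text \<open>Every coordinate vector extends to a tangent vector; a property of a tangent map thereby becomes
  a property of the derivative of its coordinate representation.\<close>

lemma coord_vector_tangent:
  assumes "smooth_manifold M" "c \<in> charts_at M p"
  shows "coord_vector M c w p \<in> tangent_space M p" "coord_vector M c w p c = w"
proof -
  have eq: "coord_vector M c w p d = frechet_derivative (chart_rep (\<lambda>x. x) c d) (at (cmap c p)) w"
    if "d \<in> charts_at M p" for d
    using that by (simp add: coord_vector_def comp_def chart_rep_def[abs_def])
  show "coord_vector M c w p c = w"
    unfolding eq[OF assms(2)] by (rule chart_rep_ident_derivative[OF assms])
  have "coord_vector M c w p e =
      frechet_derivative (chart_rep (\<lambda>x. x) d e) (at (cmap d p)) (coord_vector M c w p d)"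
    if "d \<in> charts_at M p" "e \<in> charts_at M p" for d e
    unfolding eq[OF that(1)] eq[OF that(2)]
    by (rule chart_rep_compose[OF assms(1) assms(1) smooth_map_ident smooth_map_ident])
      (use assms that in auto)
  moreover have "coord_vector M c w p d = 0" if "d \<notin> charts_at M p" for d
    using that by (simp add: coord_vector_def)
  ultimately show "coord_vector M c w p \<in> tangent_space M p"
    unfolding tangent_space_iff by blast
qed

text \<open>Independence of the chart that the definition of \<^const>\<open>tangent_map\<close> selects.\<close>

lemma tangent_map_chart:
  assumes M: "smooth_manifold M" "smooth_manifold N" "smooth_map M N f"
    and v: "v \<in> tangent_space M p" and c: "c \<in> charts_at M p" and d: "d \<in> charts_at N (f p)"
  shows "tangent_map M N f p v d = frechet_derivative (chart_rep f c d) (at (cmap c p)) (v c)"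
proof -
  let ?c = "chart_around M p"
  have c0: "?c \<in> charts_at M p"
    by (rule chart_around_in[OF M(1) charts_at_points[OF M(1) c]])
  have "tangent_map M N f p v d = frechet_derivative (chart_rep f ?c d) (at (cmap ?c p)) (v ?c)"
    using d by (simp add: tangent_map_def Let_def comp_def chart_rep_def[abs_def])
  also have "\<dots> = frechet_derivative (chart_rep f c d) (at (cmap c p))
      (frechet_derivative (chart_rep (\<lambda>x. x) ?c c) (at (cmap ?c p)) (v ?c))"
    by (rule chart_rep_compose[OF M(1,1) smooth_map_ident[OF M(1)] M(3)]) (use c0 c d in auto)
  also have "frechet_derivative (chart_rep (\<lambda>x. x) ?c c) (at (cmap ?c p)) (v ?c) = v c"
    by (rule tangent_space_chart[OF v c0 c, symmetric])
  finally show ?thesis .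
qed

lemma field_deriv_chart:
  assumes M: "smooth_manifold M" and f: "smooth_function M f"
    and v: "X p \<in> tangent_space M p" and c: "c \<in> charts_at M p"
  shows "field_deriv M X f p = frechet_derivative (f \<circ> cinv c) (at (cmap c p)) (X p c)"
proof -
  let ?c = "chart_around M p" and ?D = frechet_derivative
  let ?t = "chart_rep (\<lambda>x. x) ?c c"
  have c0: "?c \<in> charts_at M p"
    by (rule chart_around_in[OF M charts_at_points[OF M c]])
  have at: "?c \<in> atlas M" "p \<in> cdom ?c" "c \<in> atlas M" "p \<in> cdom c"
    using charts_atD[OF c0] charts_atD[OF c] by auto
  have "((\<lambda>x. (f \<circ> cinv c) (?t x)) has_derivative
      (\<lambda>w. ?D (f \<circ> cinv c) (at (cmap c p)) (?D ?t (at (cmap ?c p)) w))) (at (cmap ?c p))"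
  proof (rule has_derivative_compose[OF chart_rep_has_derivative[OF smooth_map_ident[OF M] c0 c]])
    have "smooth_on (cmap c ` cdom c) (f \<circ> cinv c)"
      using f at unfolding smooth_function_def by blast
    then show "(f \<circ> cinv c has_derivative ?D (f \<circ> cinv c) (at (cmap c p))) (at (?t (cmap ?c p)))"
      using at chart_rep_cmap[OF M c0, of "\<lambda>x. x" c] smooth_on_has_derivative by auto
  qed
  then have "(f \<circ> cinv ?c has_derivative
      (\<lambda>w. ?D (f \<circ> cinv c) (at (cmap c p)) (?D ?t (at (cmap ?c p)) w))) (at (cmap ?c p))"
  proof (rule has_derivative_transform_within_open)
    show "open (cmap ?c ` (cdom ?c \<inter> (\<lambda>x. x) -` cdom c))"
      using smooth_on_open chart_rep_smooth[OF smooth_map_ident[OF M] at(1,3)] by blast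
    show "cmap ?c p \<in> cmap ?c ` (cdom ?c \<inter> (\<lambda>x. x) -` cdom c)" using at by blast
    fix x assume "x \<in> cmap ?c ` (cdom ?c \<inter> (\<lambda>x. x) -` cdom c)"
    then show "(f \<circ> cinv c) (?t x) = (f \<circ> cinv ?c) x"
      using M at by (auto simp: chart_rep_def cinv_cmap)
  qed
  from fun_cong[OF frechet_derivative_at[OF this], of "X p ?c"]
  have "field_deriv M X f p = ?D (f \<circ> cinv c) (at (cmap c p)) (?D ?t (at (cmap ?c p)) (X p ?c))"
    by (simp add: field_deriv_def Let_def)
  also have "?D ?t (at (cmap ?c p)) (X p ?c) = X p c"
    by (rule tangent_space_chart[OF v c0 c, symmetric])
  finally show ?thesis .
qed

lemma push_field_chart:
  assumes M: "smooth_manifold M" "smooth_map M M f" "inj_on f (points M)" "p \<in> points M"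
    and "f p \<in> points M"
    and "X p \<in> tangent_space M p" "c \<in> charts_at M p" "d \<in> charts_at M (f p)"
  shows "push_field M f X (f p) d = frechet_derivative (chart_rep f c d) (at (cmap c p)) (X p c)"
  using assms tangent_map_chart[OF M(1,1,2), of "X p" p c d]
  by (simp add: push_field_def Let_def inv_into_f_f)

lemma vector_field_tangent: "X \<in> vector_fields M \<Longrightarrow> p \<in> points M \<Longrightarrow> X p \<in> tangent_space M p"
  by (simp add: vector_fields_def)

lemma vector_field_outside_chart:
  assumes "X \<in> vector_fields M" "c \<notin> charts_at M p"
  shows "X p c = 0"
proof (cases "p \<in> points M")
  case True
  then show ?thesis
    using vector_field_tangent[OF assms(1)] assms(2) unfolding tangent_space_iff by blast
next
  case False
  then have "X p = 0" using assms(1) by (simp add: vector_fields_def)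
  then show ?thesis by simp
qed

lemma vector_field_smooth:
  "X \<in> vector_fields M \<Longrightarrow> c \<in> atlas M \<Longrightarrow> smooth_on (cmap c ` cdom c) (\<lambda>x. X (cinv c x) c)"
  by (simp add: vector_fields_def)

lemma vector_field_has_derivative:
  "X \<in> vector_fields M \<Longrightarrow> c \<in> charts_at M p \<Longrightarrow>
     ((\<lambda>x. X (cinv c x) c) has_derivative
        frechet_derivative (\<lambda>x. X (cinv c x) c) (at (cmap c p))) (at (cmap c p))"
  by (rule smooth_on_has_derivative[OF vector_field_smooth]) (auto simp: charts_at_def)

section \<open>The canonical connection of a system of reflections\<close>

text \<open>The product \<open>x \<cdot> y = S (x, y)\<close> makes \<open>M\<close> a symmetric space in the sense of Loos.\<close>

locale reflection_space =
  fixes M :: "('a, 'e::euclidean_space) manifold" and S :: "'a \<times> 'a \<Rightarrow> 'a"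
  assumes manifold: "smooth_manifold M"
    and smooth: "smooth_map (prod_manifold M M) M S"
    and reflection: "x \<in> points M \<Longrightarrow> infinitesimal_reflection M x (\<lambda>y. S (x, y))"
    and conjugation: "\<lbrakk>x \<in> points M; y \<in> points M; z \<in> points M\<rbrakk> \<Longrightarrow>
      S (x, S (y, S (x, z))) = S (S (x, y), z)"
begin

lemma
  assumes "x \<in> points M"
  shows sym_smooth: "smooth_map M M (\<lambda>y. S (x, y))"
    and sym_bij: "bij_betw (\<lambda>y. S (x, y)) (points M) (points M)"
    and sym_fix: "S (x, x) = x"
    and sym_tangent: "v \<in> tangent_space M x \<Longrightarrow> tangent_map M M (\<lambda>y. S (x, y)) x v = - v"
  using reflection[OF assms] unfolding infinitesimal_reflection_def diffeomorphism_def by auto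

lemma sym_closed: "x \<in> points M \<Longrightarrow> y \<in> points M \<Longrightarrow> S (x, y) \<in> points M"
  using sym_bij bij_betw_apply by fastforce

text \<open>For \<open>y = x\<close> the conjugation law reads \<open>s\<^sub>x \<circ> s\<^sub>x \<circ> s\<^sub>x = s\<^sub>x\<close>, and \<open>s\<^sub>x\<close> is injective.\<close>

lemma sym_involution:
  assumes "x \<in> points M" "y \<in> points M"
  shows "S (x, S (x, y)) = y"
proof -
  have "S (x, S (x, S (x, y))) = S (x, y)"
    using conjugation[OF assms(1,1,2)] sym_fix[OF assms(1)] by simp
  then show ?thesis
    using bij_betw_imp_inj_on[OF sym_bij[OF assms(1)]] assms sym_closed by (meson inj_onD)
qed

lemma sym_automorphism:
  assumes "x \<in> points M" "y \<in> points M" "z \<in> points M"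
  shows "S (x, S (y, z)) = S (S (x, y), S (x, z))"
  using conjugation[OF assms(1,2) sym_closed[OF assms(1,3)]] sym_involution[OF assms(1,3)] by simp

abbreviation refl_rep :: "'a \<Rightarrow> ('a, 'e) chart \<Rightarrow> 'e \<Rightarrow> 'e" where
  "refl_rep p c \<equiv> chart_rep (\<lambda>y. S (p, y)) c c"

lemma
  assumes c: "c \<in> charts_at M p"
  shows refl_rep_smooth: "smooth_on (cmap c ` (cdom c \<inter> (\<lambda>y. S (p, y)) -` cdom c)) (refl_rep p c)"
    and refl_rep_dom: "cmap c p \<in> cmap c ` (cdom c \<inter> (\<lambda>y. S (p, y)) -` cdom c)"
    and refl_rep_fix: "refl_rep p c (cmap c p) = cmap c p"
    and refl_rep_derivative: "frechet_derivative (refl_rep p c) (at (cmap c p)) w = - w"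
proof -
  have p: "p \<in> points M" using charts_at_points[OF manifold c] .
  have c': "c \<in> atlas M" "p \<in> cdom c" using charts_atD[OF c] by auto
  show "smooth_on (cmap c ` (cdom c \<inter> (\<lambda>y. S (p, y)) -` cdom c)) (refl_rep p c)"
    by (rule chart_rep_smooth[OF sym_smooth[OF p] c'(1,1)])
  show "cmap c p \<in> cmap c ` (cdom c \<inter> (\<lambda>y. S (p, y)) -` cdom c)"
    using c' sym_fix[OF p] by auto
  show "refl_rep p c (cmap c p) = cmap c p"
    by (simp add: chart_rep_cmap[OF manifold c] sym_fix[OF p])
  let ?v = "coord_vector M c w p"
  have v: "?v \<in> tangent_space M p" "?v c = w"
    using coord_vector_tangent[OF manifold c] by auto
  have "frechet_derivative (refl_rep p c) (at (cmap c p)) (?v c) =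
      tangent_map M M (\<lambda>y. S (p, y)) p ?v c"
    by (rule tangent_map_chart[OF manifold manifold sym_smooth[OF p] v(1) c, symmetric])
      (simp add: sym_fix[OF p] c)
  also have "\<dots> = - w" using sym_tangent[OF p v(1)] v(2) by simp
  finally show "frechet_derivative (refl_rep p c) (at (cmap c p)) w = - w" using v(2) by simp
qed

text \<open>In a chart \<open>(\<nabla>\<^sub>X Y)(p) = DY(X) + \<Gamma>\<^sub>p(X, Y)\<close> with Christoffel form \<open>\<Gamma>\<^sub>p = - D\<^sup>2s\<^sub>p(p)/2\<close>. This form is forced:
  the condition that \<open>s\<^sub>p\<close> preserves a connection at \<open>p\<close>, where \<open>D s\<^sub>p = -id\<close>, reads
  \<open>-\<Gamma>\<^sub>p = D\<^sup>2s\<^sub>p(p) + \<Gamma>\<^sub>p\<close>. Equivalently \<open>(\<nabla>\<^sub>X Y)(p) = [X, Y + (s\<^sub>p)\<^sub>* Y](p)/2\<close>, where the second field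
  vanishes at \<open>p\<close>.\<close>

definition nabla ::
  "('a \<Rightarrow> ('a, 'e) tvec) \<Rightarrow> ('a \<Rightarrow> ('a, 'e) tvec) \<Rightarrow> 'a \<Rightarrow> ('a, 'e) tvec" where
  "nabla X Y p =
     (\<lambda>c. if c \<in> charts_at M p
          then frechet_derivative (\<lambda>x. Y (cinv c x) c) (at (cmap c p)) (X p c)
             - (1/2) *\<^sub>R second_deriv (refl_rep p c) (cmap c p) (X p c) (Y p c)
          else 0)"

lemma nabla_chart:
  "c \<in> charts_at M p \<Longrightarrow> nabla X Y p c =
     frechet_derivative (\<lambda>x. Y (cinv c x) c) (at (cmap c p)) (X p c)
       - (1/2) *\<^sub>R second_deriv (refl_rep p c) (cmap c p) (X p c) (Y p c)"
  by (simp add: nabla_def)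

text \<open>Stated for one pair of charts and for automorphisms \<open>f\<close> of the product, so that it also covers the
  coordinate changes: these are the case where \<open>f\<close> is the identity.\<close>

lemma nabla_natural:
  assumes f: "smooth_map M M f" and g: "smooth_map M M g"
    and fg: "\<And>q. q \<in> points M \<Longrightarrow> f q \<in> points M \<and> g q \<in> points M \<and> g (f q) = q \<and> f (g q) = q"
    and aut: "\<And>q r. q \<in> points M \<Longrightarrow> r \<in> points M \<Longrightarrow> f (S (q, r)) = S (f q, f r)"
    and X: "X' (f p) d = frechet_derivative (chart_rep f c d) (at (cmap c p)) (X p c)"
    and Y: "Y \<in> vector_fields M"
    and Y': "\<And>q. c \<in> charts_at M q \<Longrightarrow> d \<in> charts_at M (f q) \<Longrightarrow>
      Y' (f q) d = frechet_derivative (chart_rep f c d) (at (cmap c q)) (Y q c)"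
    and c: "c \<in> charts_at M p" and d: "d \<in> charts_at M (f p)"
  shows "nabla X' Y' (f p) d =
           frechet_derivative (chart_rep f c d) (at (cmap c p)) (nabla X Y p c)"
proof -
  let ?D = frechet_derivative and ?\<phi> = "chart_rep f c d" and ?\<psi> = "chart_rep g d c"
  let ?U = "cmap c ` (cdom c \<inter> f -` cdom d)" and ?V = "cmap d ` (cdom d \<inter> g -` cdom c)"
  let ?y = "\<lambda>x. Y (cinv c x) c" and ?y' = "\<lambda>x. Y' (cinv d x) d"
  have p: "p \<in> points M" using charts_at_points[OF manifold c] .
  have at: "c \<in> atlas M" "p \<in> cdom c" "d \<in> atlas M" "f p \<in> cdom d"
    using charts_atD[OF c] charts_atD[OF d] by auto
  have sub: "cdom c \<subseteq> points M" "cdom d \<subseteq> points M" using cdom_subset[OF manifold] at by auto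
  have inv: "cinv c (cmap c q) = q" if "q \<in> cdom c" for q using cinv_cmap[OF manifold at(1) that] .
  have inv': "cinv d (cmap d q) = q" if "q \<in> cdom d" for q using cinv_cmap[OF manifold at(3) that] .
  have \<phi>: "smooth_on ?U ?\<phi>" by (rule chart_rep_smooth[OF f at(1,3)])
  have \<psi>: "smooth_on ?V ?\<psi>" by (rule chart_rep_smooth[OF g at(3,1)])
  have aU: "cmap c p \<in> ?U" and \<phi>a: "?\<phi> (cmap c p) = cmap d (f p)"
    and bV: "cmap d (f p) \<in> ?V" and \<psi>b: "?\<psi> (cmap d (f p)) = cmap c p"
    using at fg[OF p] chart_rep_cmap[OF manifold c, of f d] chart_rep_cmap[OF manifold d, of g c]
    by auto
  have push: "?y' (?\<phi> x) = ?D ?\<phi> (at x) (?y x)" if x: "x \<in> ?U" for x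
  proof -
    obtain q where q: "x = cmap c q" "q \<in> cdom c" "f q \<in> cdom d" using x by auto
    then show ?thesis
      using Y'[OF charts_atI[OF at(1) q(2)] charts_atI[OF at(3) q(3)]]
      by (simp add: chart_rep_def inv inv')
  qed
  have dy: "(?y has_derivative ?D ?y (at (cmap c p))) (at (?\<psi> (cmap d (f p))))"
    using vector_field_has_derivative[OF Y c] \<psi>b by simp
  note d\<psi> = smooth_on_has_derivative[OF \<psi> bV]
  \<comment> \<open>Differentiability of the pushed forward field: near \<open>f p\<close> it is the explicit expression in \<open>\<psi>\<close>.\<close>
  have "(\<lambda>x. ?D ?\<phi> (at (?\<psi> x)) (?y (?\<psi> x))) differentiable (at (cmap d (f p)))"
    using has_derivative_derivative_along[of ?U ?\<phi> ?\<psi>, OF \<phi> _ d\<psi> has_derivative_compose[OF d\<psi> dy]] aU \<psi>b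
    unfolding differentiable_def by auto
  then have y': "?y' differentiable (at (cmap d (f p)))"
  proof (rule frechet_derivative_open_cong(1)[OF _ smooth_on_open[OF \<psi>] bV])
    fix x assume "x \<in> ?V"
    then obtain q where q: "x = cmap d q" "q \<in> cdom d" "g q \<in> cdom c" by auto
    then have "q \<in> points M" using sub by auto
    then have "?\<psi> x \<in> ?U" "?\<phi> (?\<psi> x) = x"
      using q fg by (auto simp: chart_rep_def inv inv' intro!: imageI)
    then show "?D ?\<phi> (at (?\<psi> x)) (?y (?\<psi> x)) = ?y' x" using push by metis
  qed
  have comm: "refl_rep (f p) d (?\<phi> x) = ?\<phi> (refl_rep p c x)"
    if x: "x \<in> ?U" "x \<in> cmap c ` (cdom c \<inter> (\<lambda>y. S (p, y)) -` cdom c)" for x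
  proof -
    obtain q where q: "x = cmap c q" "q \<in> cdom c" "f q \<in> cdom d" using x(1) by auto
    obtain q' where "x = cmap c q'" "q' \<in> cdom c" "S (p, q') \<in> cdom c" using x(2) by auto
    then have "S (p, q) \<in> cdom c" using q inv by metis
    then show ?thesis
      using q aut[OF p, of q] sub by (auto simp: chart_rep_def inv inv')
  qed
  have Y'p: "Y' (f p) d = ?y' (cmap d (f p))" "Y p c = ?y (cmap c p)"
    using inv inv' at by auto
  show ?thesis
    unfolding nabla_chart[OF c] nabla_chart[OF d] X Y'p \<phi>a[symmetric]
    by (rule reflection_connection_natural[OF \<phi> aU refl_rep_smooth[OF c] refl_rep_dom[OF c]
          refl_rep_fix[OF c] refl_rep_derivative[OF c], where W = "cmap d ` (cdom d \<inter> (\<lambda>y. S (f p, y)) -` cdom d)"])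
      (use refl_rep_smooth[OF d] refl_rep_dom[OF d] refl_rep_derivative[OF d] comm push y' dy \<psi>b in
        \<open>simp_all add: \<phi>a differentiableI\<close>)
qed

text \<open>The components of a tangent vector in two charts must be related by the coordinate change, which
  is naturality under the identity map.\<close>

lemma nabla_tangent:
  assumes X: "X \<in> vector_fields M" and Y: "Y \<in> vector_fields M" and p: "p \<in> points M"
  shows "nabla X Y p \<in> tangent_space M p"
  unfolding tangent_space_iff
proof (intro conjI ballI allI impI)
  fix c d assume c: "c \<in> charts_at M p" and d: "d \<in> charts_at M p"
  have tr: "Z q d = frechet_derivative (chart_rep (\<lambda>x. x) c d) (at (cmap c q)) (Z q c)"
    if "Z \<in> vector_fields M" "c \<in> charts_at M q" "d \<in> charts_at M q" for Z q
    by (rule tangent_space_chart[OF vector_field_tangent[OF that(1)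
          charts_at_points[OF manifold that(2)]] that(2,3)])
  show "nabla X Y p d = frechet_derivative (chart_rep (\<lambda>x. x) c d) (at (cmap c p)) (nabla X Y p c)"
    by (rule nabla_natural[of "\<lambda>x. x" "\<lambda>x. x" X p d c X Y Y])
      (use smooth_map_ident[OF manifold] tr X Y c d in auto)
qed (simp add: nabla_def)

text \<open>The Christoffel form at \<open>p\<close> involves derivatives of \<open>s\<^sub>p\<close> only in its own argument, but has to depend
  smoothly on the parameter \<open>p\<close>. Hence it is read off from the map \<open>F(a, y)\<close> representing \<open>S\<close> on the
  product: two partial derivatives in the second variable, along the two vector fields, and then the
  restriction to the diagonal.\<close>

lemma nabla_smooth:
  assumes X: "X \<in> vector_fields M" and Y: "Y \<in> vector_fields M" and c: "c \<in> atlas M"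
  shows "smooth_on (cmap c ` cdom c) (\<lambda>x. nabla X Y (cinv c x) c)"
proof -
  let ?D = frechet_derivative and ?U = "cmap c ` cdom c"
  let ?x = "\<lambda>x. X (cinv c x) c" and ?y = "\<lambda>x. Y (cinv c x) c"
  define W where "W = map_prod (cmap c) (cmap c) ` ((cdom c \<times> cdom c) \<inter> S -` cdom c)"
  define F where "F = (\<lambda>z. cmap c (S (cinv c (fst z), cinv c (snd z))))"
  have inv: "cinv c (cmap c q) = q" if "q \<in> cdom c" for q using cinv_cmap[OF manifold c that] .
  have sub: "cdom c \<subseteq> points M" using cdom_subset[OF manifold c] .
  have F: "smooth_on W F"
  proof -
    let ?c = "(cdom c \<times> cdom c, map_prod (cmap c) (cmap c))"
    have "?c \<in> atlas (prod_manifold M M)"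
      unfolding prod_manifold_def manifold.select_convs mem_Collect_eq
      by (intro exI[of _ c] conjI refl c)
    from chart_rep_smooth[OF smooth this c] have "smooth_on W (chart_rep S ?c c)"
      by (simp add: W_def)
    moreover have "chart_rep S ?c c z = F z" if "z \<in> W" for z
    proof -
      obtain q r where z: "z = map_prod (cmap c) (cmap c) (q, r)" "q \<in> cdom c" "r \<in> cdom c"
        using \<open>z \<in> W\<close> by (auto simp: W_def)
      have "inj_on (map_prod (cmap c) (cmap c)) (cdom c \<times> cdom c)"
        using map_prod_inj_on chart_inj[OF manifold c] by blast
      then have "cinv ?c z = (q, r)"
        unfolding cinv_def z(1) using z(2,3) by (simp only: fst_conv snd_conv inv_into_f_f mem_Sigma_iff)
      then show ?thesis using z by (simp add: chart_rep_def F_def inv)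
    qed
    ultimately show ?thesis using smooth_on_cong by blast
  qed
  have fstW: "fst ` W \<subseteq> ?U" by (auto simp: W_def)
  have diag: "(a, a) \<in> W" if "a \<in> ?U" for a
    using that sub sym_fix by (force simp: W_def)
  have sm_fst: "smooth_on W (\<lambda>z. h (fst z))" if "smooth_on ?U h" for h :: "'e \<Rightarrow> 'e"
    by (rule smooth_on_compose[OF smooth_on_bounded_linear[OF bounded_linear_fst
          smooth_on_id[OF smooth_on_open[OF F]]] that fstW])
  have sm_pair: "smooth_on W (\<lambda>z. (0::'e, h z))" if "smooth_on W h" for h :: "'e \<times> 'e \<Rightarrow> 'e"
    by (rule smooth_on_bounded_linear[OF _ that]) 
      (intro bounded_linear_Pair bounded_linear_zero bounded_linear_ident)
  define G where "G = (\<lambda>z. ?D F (at z) (0, ?y (fst z)))"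
  have G: "smooth_on W G"
    unfolding G_def
    by (intro smooth_on_derivative_along F sm_pair sm_fst vector_field_smooth[OF Y c])
  define K where "K = (\<lambda>z. ?D G (at z) (0, ?x (fst z)))"
  have K: "smooth_on W K"
    unfolding K_def
    by (intro smooth_on_derivative_along G sm_pair sm_fst vector_field_smooth[OF X c])
  have slice: "((\<lambda>y. (a, y)) has_derivative (\<lambda>v. (0, v))) (at y)" for a y :: 'e
    by (intro derivative_eq_intros) auto
  have second_deriv_eq: "second_deriv (refl_rep (cinv c a) c) a (?x a) (?y a) = K (a, a)" if a: "a \<in> ?U" for a
  proof -
    have Fa: "refl_rep (cinv c a) c = (\<lambda>y. F (a, y))"
      by (simp add: fun_eq_iff chart_rep_def F_def)
    have D1: "?D (\<lambda>y. F (a, y)) (at y) (?y a) = G (a, y)" if "(a, y) \<in> W" for y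
      using frechet_derivative_at[OF has_derivative_compose[OF slice smooth_on_has_derivative[OF F that]]]
      by (metis G_def fst_conv)
    have "((\<lambda>y. G (a, y)) has_derivative (\<lambda>v. ?D G (at (a, a)) (0, v))) (at a)"
      by (rule has_derivative_compose[OF slice smooth_on_has_derivative[OF G diag[OF a]]])
    then have "((\<lambda>y. ?D (\<lambda>y. F (a, y)) (at y) (?y a)) has_derivative
        (\<lambda>v. ?D G (at (a, a)) (0, v))) (at a)"
    proof (rule has_derivative_transform_within_open)
      show "open (Pair a -` W)"
        by (rule open_vimage[OF smooth_on_open[OF F]]) (intro continuous_intros)
      show "a \<in> Pair a -` W" using diag[OF a] by simp
    qed (use D1 in auto)
    from frechet_derivative_at[OF this] show ?thesis
      unfolding second_deriv_def Fa K_def by (metis fst_conv)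
  qed
  have "smooth_on ?U (\<lambda>a. ?D ?y (at a) (?x a) + (- (1/2)) *\<^sub>R K (a, a))"
  proof (intro smooth_on_add smooth_on_derivative_along vector_field_smooth[OF X c]
      vector_field_smooth[OF Y c] smooth_on_bounded_linear[OF bounded_linear_scaleR_right])
    have "smooth_on ?U (\<lambda>a. (a, a))"
      by (rule smooth_on_bounded_linear[OF _ smooth_on_id[OF chart_image_open[OF manifold c]]])
        (intro bounded_linear_Pair bounded_linear_ident)
    then show "smooth_on ?U (\<lambda>a. K (a, a))"
      using smooth_on_compose K diag by blast
  qed
  then show ?thesis
  proof (rule smooth_on_cong[rotated])
    fix a assume a: "a \<in> ?U"
    then have "c \<in> charts_at M (cinv c a)" "cmap c (cinv c a) = a"
      using c inv by (auto intro: charts_atI)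
    then show "?D ?y (at a) (?x a) + (- (1/2)) *\<^sub>R K (a, a) = nabla X Y (cinv c a) c"
      using second_deriv_eq[OF a] by (simp add: nabla_chart)
  qed
qed

lemma nabla_outside: "p \<notin> points M \<Longrightarrow> nabla X Y p = 0"
  using charts_at_points[OF manifold] by (auto simp: nabla_def zero_fun_def fun_eq_iff)

text \<open>All axioms hold chart by chart: the first term satisfies them by the linearity and product rules of
  the derivative, the second because it is bilinear over functions.\<close>

lemma nabla_affine_connection: "affine_connection M nabla"
  unfolding affine_connection_def
proof (intro conjI ballI allI impI)
  let ?D = frechet_derivative
  note hl = second_deriv_linear_left[OF refl_rep_smooth refl_rep_dom]
    and hr = second_deriv_linear_right[OF refl_rep_smooth refl_rep_dom]
  have lin: "linear (?D (\<lambda>x. Y (cinv c x) c) (at (cmap c p)))"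
    if "Y \<in> vector_fields M" "c \<in> charts_at M p" for Y c p
    using vector_field_has_derivative[OF that] has_derivative_linear by blast
  fix X Y assume X: "X \<in> vector_fields M" and Y: "Y \<in> vector_fields M"
  show "nabla X Y \<in> vector_fields M"
    using nabla_tangent[OF X Y] nabla_outside nabla_smooth[OF X Y]
    by (simp add: vector_fields_def)
  show "nabla (X + X') Y = nabla X Y + nabla X' Y" for X'
  proof (intro ext)
    fix p c
    show "nabla (X + X') Y p c = (nabla X Y + nabla X' Y) p c"
    proof (cases "c \<in> charts_at M p")
      case True
      then show ?thesis
        by (simp add: nabla_chart linear_add[OF lin[OF Y True]] linear_add[OF hl[OF True True]]
            scaleR_add_right)
    qed (simp add: nabla_def)
  qed
  show "nabla X (Y + Y') = nabla X Y + nabla X Y'" if Y': "Y' \<in> vector_fields M" for Y'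
  proof (intro ext)
    fix p c
    show "nabla X (Y + Y') p c = (nabla X Y + nabla X Y') p c"
    proof (cases "c \<in> charts_at M p")
      case True
      have "?D (\<lambda>x. Y (cinv c x) c + Y' (cinv c x) c) (at (cmap c p)) u =
          ?D (\<lambda>x. Y (cinv c x) c) (at (cmap c p)) u + ?D (\<lambda>x. Y' (cinv c x) c) (at (cmap c p)) u" for u
        by (rule fun_cong[OF frechet_derivative_at[OF has_derivative_add[OF
                vector_field_has_derivative[OF Y True] vector_field_has_derivative[OF Y' True]]],
              symmetric])
      then show ?thesis
        by (simp add: nabla_chart True linear_add[OF hr[OF True True]] scaleR_add_right)
    qed (simp add: nabla_def)
  qed
  fix f assume f: "smooth_function M f"
  show "nabla (\<lambda>p. f p *\<^sub>R X p) Y = (\<lambda>p. f p *\<^sub>R nabla X Y p)"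
  proof (intro ext)
    fix p c
    show "nabla (\<lambda>p. f p *\<^sub>R X p) Y p c = (f p *\<^sub>R nabla X Y p) c"
    proof (cases "c \<in> charts_at M p")
      case True
      then show ?thesis
        by (simp add: nabla_chart scaleR_fun_def linear_scale[OF lin[OF Y True]]
            linear_scale[OF hl[OF True True]] scaleR_diff_right)
    qed (simp add: nabla_def scaleR_fun_def)
  qed
  show "nabla X (\<lambda>p. f p *\<^sub>R Y p) = (\<lambda>p. field_deriv M X f p *\<^sub>R Y p + f p *\<^sub>R nabla X Y p)"
  proof (intro ext)
    fix p c
    show "nabla X (\<lambda>p. f p *\<^sub>R Y p) p c = (field_deriv M X f p *\<^sub>R Y p + f p *\<^sub>R nabla X Y p) c"
    proof (cases "c \<in> charts_at M p")
      case True
      have c: "c \<in> atlas M" "p \<in> cdom c" using charts_atD[OF True] by auto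
      have p: "p \<in> points M" using charts_at_points[OF manifold True] .
      have "((f \<circ> cinv c) has_derivative ?D (f \<circ> cinv c) (at (cmap c p))) (at (cmap c p))"
        by (rule smooth_on_has_derivative) (use f c in \<open>auto simp: smooth_function_def\<close>)
      from frechet_derivative_at[OF has_derivative_scaleR[OF this vector_field_has_derivative[OF Y True]]]
      have "?D (\<lambda>x. f (cinv c x) *\<^sub>R Y (cinv c x) c) (at (cmap c p)) (X p c) =
          f p *\<^sub>R ?D (\<lambda>x. Y (cinv c x) c) (at (cmap c p)) (X p c) + field_deriv M X f p *\<^sub>R Y p c"
        unfolding field_deriv_chart[of M f X p c, OF manifold f vector_field_tangent[OF X p] True]
        by (simp add: fun_eq_iff comp_def cinv_cmap[OF manifold c])
      then show ?thesis
        by (simp add: nabla_chart True scaleR_fun_def linear_scale[OF hr[OF True True]] scaleR_diff_right)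
    next
      case False
      then have "Y p c = 0"
        using vector_field_outside_chart[OF Y] by blast
      with False show ?thesis by (simp add: nabla_def scaleR_fun_def)
    qed
  qed
qed

text \<open>Naturality under \<open>s\<^sub>x\<close>, an automorphism of the product that is its own inverse.\<close>

lemma nabla_sym_affine:
  assumes x: "x \<in> points M"
  shows "affine_transformation M nabla (\<lambda>y. S (x, y))"
  unfolding affine_transformation_def
proof (intro conjI ballI)
  let ?s = "\<lambda>y. S (x, y)"
  show "diffeomorphism M M ?s"
    using reflection[OF x] by (simp add: infinitesimal_reflection_def)
  fix X Y assume X: "X \<in> vector_fields M" and Y: "Y \<in> vector_fields M"
  have push: "push_field M ?s Z (S (x, q)) d =
      frechet_derivative (chart_rep ?s c d) (at (cmap c q)) (Z q c)"
    if "q \<in> points M" "Z q \<in> tangent_space M q" "c \<in> charts_at M q" "d \<in> charts_at M (S (x, q))"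
    for Z q c d
    using push_field_chart[where f = ?s and X = Z, OF manifold sym_smooth[OF x]
        bij_betw_imp_inj_on[OF sym_bij[OF x]] that(1) sym_closed[OF x that(1)] that(2-4)] .
  show "push_field M ?s (nabla X Y) = nabla (push_field M ?s X) (push_field M ?s Y)"
  proof (intro ext)
    fix q d
    show "push_field M ?s (nabla X Y) q d = nabla (push_field M ?s X) (push_field M ?s Y) q d"
    proof (cases "d \<in> charts_at M q")
      case True
      have q: "q \<in> points M" using charts_at_points[OF manifold True] .
      define p where "p = S (x, q)"
      have p: "p \<in> points M" and qp: "q = S (x, p)"
        using sym_closed[OF x q] sym_involution[OF x q] by (auto simp: p_def)
      define c where "c = chart_around M p"
      have c: "c \<in> charts_at M p" using chart_around_in[OF manifold p] by (simp add: c_def)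
      have "push_field M ?s (nabla X Y) (S (x, p)) d =
          frechet_derivative (chart_rep ?s c d) (at (cmap c p)) (nabla X Y p c)"
        by (rule push[where Z = "nabla X Y", OF p nabla_tangent[OF X Y p] c]) (use True qp in simp)
      moreover have "nabla (push_field M ?s X) (push_field M ?s Y) (S (x, p)) d =
          frechet_derivative (chart_rep ?s c d) (at (cmap c p)) (nabla X Y p c)"
      proof (rule nabla_natural[OF sym_smooth[OF x] sym_smooth[OF x]])
        show "push_field M ?s X (S (x, p)) d =
            frechet_derivative (chart_rep ?s c d) (at (cmap c p)) (X p c)"
          by (rule push[where Z = X, OF p vector_field_tangent[OF X p] c]) (use True qp in simp)
        show "push_field M ?s Y (S (x, r)) d =
            frechet_derivative (chart_rep ?s c d) (at (cmap c r)) (Y r c)"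
          if "c \<in> charts_at M r" "d \<in> charts_at M (S (x, r))" for r
          using charts_at_points[OF manifold that(1)] that
          by (intro push[where Z = Y] vector_field_tangent[OF Y])
        show "S (x, r) \<in> points M \<and> S (x, r) \<in> points M \<and> S (x, S (x, r)) = r \<and> S (x, S (x, r)) = r"
          if "r \<in> points M" for r
          using sym_closed[OF x that] sym_involution[OF x that] by simp
        show "S (x, S (r, t)) = S (S (x, r), S (x, t))" if "r \<in> points M" "t \<in> points M" for r t
          by (rule sym_automorphism[OF x that])
      qed (use Y c True qp in simp_all)
      ultimately show ?thesis by (simp add: qp)
    next
      case False
      then show ?thesis
        unfolding nabla_def push_field_def tangent_map_def Let_def
        using bij_betw_inv_into_right[OF sym_bij[OF x]] by simp
    qed
  qed
qed

lemma affine_symmetric: "affine_symmetric_space M S"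
  unfolding affine_symmetric_space_def
  using manifold reflection nabla_affine_connection nabla_sym_affine by blast

end

section \<open>Smooth systems of symmetries\<close>

theorem mainTheorem2:
  fixes G :: "'g monoid" and LG :: "('g, 'h::euclidean_space) manifold"
    and gr :: "int \<Rightarrow> ('g, 'h) tvec set"
    and LP :: "('g, 'p::euclidean_space) manifold"
    and E :: "('u, 'k::euclidean_space) manifold"
    and M :: "('a, 'e::euclidean_space) manifold"
    and proj :: "'u \<Rightarrow> 'a" and act :: "'u \<Rightarrow> 'g \<Rightarrow> 'u"
    and omega :: "'u \<Rightarrow> ('u, 'k) tvec \<Rightarrow> ('g, 'h) tvec"
    and S :: "'a \<times> 'a \<Rightarrow> 'a"
  assumes "one_graded_parabolic_geometry G LG gr LP E M proj act omega"
    and "effective_type G (parabolic_subgroup G LG gr)"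
    and "connected_space (mtop M)"
    and "smooth_system_of_symmetries (parabolic_subgroup G LG gr) E M proj act omega S"
    and "\<And>x y z. \<lbrakk>x \<in> points M; y \<in> points M; z \<in> points M\<rbrakk> \<Longrightarrow>
           S (x, S (y, S (x, z))) = S (S (x, y), z)"
  shows "affine_symmetric_space M S"
proof -
  interpret reflection_space M S
  proof
    show "smooth_manifold M"
      using assms(1) by (simp add: one_graded_parabolic_geometry_def principal_bundle_def Let_def)
  qed (use assms(4,5) in \<open>auto simp: smooth_system_of_symmetries_def symmetry_at_def\<close>)
  show ?thesis by (rule affine_symmetric)
qed

end
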